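(* Let $\Omega\subset\mathbb{C}^n$ be a bounded pseudoconvex domain with smooth boundary, with signed distance function $\delta$ and normalized complex gradient $N=N_\delta$. Let $U$ be an arbitrary coordinate chart and let $L$ be a nonvanishing smooth vector field of type $(1,0)$ on $U$ satisfying $L\delta=0$ in a neighborhood of $\partial\Omega$. Then $$\langle \nabla_L\nabla_N N, L\rangle\leq 0$$ at every point of $$\Sigma_L:=\{p\in U\cap\partial\Omega:\ \operatorname{Hess}_\delta(L,L)=0\text{ at }p\}.$$
   Context: The signed distance function is $\delta(x)=\operatorname{dist}(x,\partial\Omega)$ for $x\in\Omega^c$ and $\delta(x)=-\operatorname{dist}(x,\partial\Omega)$ for $x\in\Omega$; it is smooth near $\partial\Omega$, and all quantities are considered there. $\Omega$ is pseudoconvex if $\operatorname{Hess}_\delta(L_p,L_p)\ge 0$ for all $p\in\partial\Omega$ and all $L_p\in T^{1,0}_p(\partial\Omega)$ (Levi pseudoconvexity), equivalently if $-\log(-\delta)$ is plurisubharmonic in $\Omega$. $\langle\cdot,\cdot\rangle$ is the standard Euclidean inner product of $\mathbb{C}^n=\mathbb{R}^{2n}$ extended to complexified tangent vectors as a Hermitian form (linear in the first slot, conjugate-linear in the second), so that $\langle\partial/\partial z^i,\partial/\partial z^j\rangle=\tfrac12\delta_{ij}$ and $T^{(1,0)}\perp T^{(0,1)}$; $|\cdot|$ is the associated norm. $\nabla_XY$ is the flat (Euclidean) covariant derivative, extended complex-bilinearly to complex vector fields, i.e. componentwise differentiation of $Y$ along $X$; $\nabla f$ is the real gradient of a function $f$.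 For $X=\sum_i X^i\partial/\partial z^i$ of type $(1,0)$, $\operatorname{Hess}_f(X,X)=X\overline{X}f-(\nabla_X\overline{X})f=\langle\nabla_X\nabla f,X\rangle=\sum_{i,j}\frac{\partial^2 f}{\partial z^i\partial\bar z^j}X^i\overline{X^j}$ is the complex Hessian. For a real function $\rho$, $D\rho=\sum_i\frac{\partial\rho}{\partial\bar z^i}\frac{\partial}{\partial z^i}$ is the complex gradient, $N_\rho=|D\rho|^{-1}D\rho$, and $N=N_\delta$. In particular $|D\delta|^2=\tfrac18$, $|N|=1$, $N+\overline N=\sqrt2\,\nabla\delta$ and $N\delta=\tfrac1{\sqrt2}$ near $\partial\Omega$. *)

theory Defs
  imports "HOL-Analysis.Analysis" "HOL-Library.Complex_Order"
begin

text \<open>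
  \<open>\<complex>\<^sup>n\<close> is \<^typ>\<open>complex^'n\<close>; its library distance, norm and Frechet derivatives are those of
  the underlying real Euclidean space \<open>\<real>\<^sup>2\<^sup>n\<close>. The order on \<^typ>\<open>complex\<close> is that of
  \<^theory>\<open>HOL-Library.Complex_Order\<close>: \<open>z \<le> 0\<close> says that \<open>z\<close> is real and nonpositive.
\<close>

subsection \<open>Smoothness\<close>

text \<open>Both predicates are meant for open \<open>S\<close>.\<close>

fun continuously_diff_on ::
  "nat \<Rightarrow> 'a::euclidean_space set \<Rightarrow> ('a \<Rightarrow> 'b::real_normed_vector) \<Rightarrow> bool" where
  "continuously_diff_on 0 S f \<longleftrightarrow> continuous_on S f"
| "continuously_diff_on (Suc k) S f \<longleftrightarrow>
     (\<forall>x\<in>S. f differentiable (at x)) \<and>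
     (\<forall>v. continuously_diff_on k S (\<lambda>x. frechet_derivative f (at x) v))"

definition smooth_on :: "'a::euclidean_space set \<Rightarrow> ('a \<Rightarrow> 'b::real_normed_vector) \<Rightarrow> bool" where
  "smooth_on S f \<longleftrightarrow> (\<forall>k. continuously_diff_on k S f)"

text \<open>
  A local defining function near each boundary point. Only \<open>\<Omega>\<close> is described; that
  \<open>frontier \<Omega>\<close> is \<open>{q. \<rho> q = 0}\<close> near \<open>p\<close> follows from the derivative being nonzero.
\<close>

definition smooth_boundary :: "'a::euclidean_space set \<Rightarrow> bool" where
  "smooth_boundary \<Omega> \<longleftrightarrow>
     (\<forall>p\<in>frontier \<Omega>. \<exists>V (\<rho> :: 'a \<Rightarrow> real).
        open V \<and> p \<in> V \<and> smooth_on V \<rho> \<and>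
        (\<forall>q\<in>V. frechet_derivative \<rho> (at q) \<noteq> (\<lambda>_. 0)) \<and>
        \<Omega> \<inter> V = {q \<in> V. \<rho> q < 0})"

definition signed_dist :: "'a::metric_space set \<Rightarrow> 'a \<Rightarrow> real" where
  "signed_dist \<Omega> x =
     (if x \<in> \<Omega> then - infdist x (frontier \<Omega>) else infdist x (frontier \<Omega>))"

subsection \<open>Calculus of vector fields of type \<open>(1,0)\<close>\<close>

text \<open>
  A tangent vector \<open>\<Sum>i. X\<^sup>i \<partial>/\<partial>z\<^sup>i\<close> of type \<open>(1,0)\<close> is represented by its coefficient vector
  \<open>X :: complex^'n\<close>, a vector field of type \<open>(1,0)\<close> by the map to its coefficients.
\<close>

definition dz :: "'n::finite \<Rightarrow> (complex^'n \<Rightarrow> complex) \<Rightarrow> complex^'n \<Rightarrow> complex" where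
  "dz i f p = (frechet_derivative f (at p) (axis i 1)
               - \<i> * frechet_derivative f (at p) (axis i \<i>)) / 2"

definition dzbar :: "'n::finite \<Rightarrow> (complex^'n \<Rightarrow> complex) \<Rightarrow> complex^'n \<Rightarrow> complex" where
  "dzbar i f p = (frechet_derivative f (at p) (axis i 1)
                  + \<i> * frechet_derivative f (at p) (axis i \<i>)) / 2"

definition vec_deriv :: "complex^'n \<Rightarrow> (complex^'n \<Rightarrow> complex) \<Rightarrow> complex^'n \<Rightarrow> complex" where
  "vec_deriv X f p = (\<Sum>i\<in>UNIV. X $ i * dz i f p)"

text \<open>The flat covariant derivative \<open>\<nabla>\<^sub>X Y\<close>.\<close>

definition cov_deriv ::
  "(complex^'n \<Rightarrow> complex^'n) \<Rightarrow> (complex^'n \<Rightarrow> complex^'n) \<Rightarrow> complex^'n \<Rightarrow> complex^'n" where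
  "cov_deriv X Y p = (\<chi> j. vec_deriv (X p) (\<lambda>q. Y q $ j) p)"

text \<open>
  The factor \<open>1/2\<close> comes from \<open>\<partial>/\<partial>z\<^sup>i = (\<partial>/\<partial>x\<^sup>i - \<i> \<partial>/\<partial>y\<^sup>i) / 2\<close>; in particular \<open>norm10\<close> differs
  from the library norm of the coefficient vector by a factor \<open>sqrt (1/2)\<close>.
\<close>

definition herm10 :: "complex^'n \<Rightarrow> complex^'n \<Rightarrow> complex" where
  "herm10 X Y = (\<Sum>i\<in>UNIV. X $ i * cnj (Y $ i)) / 2"

definition norm10 :: "complex^'n \<Rightarrow> real" where
  "norm10 X = sqrt (Re (herm10 X X))"

definition cgrad :: "(complex^'n \<Rightarrow> real) \<Rightarrow> complex^'n \<Rightarrow> complex^'n" where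
  "cgrad \<rho> p = (\<chi> i. dzbar i (\<lambda>q. complex_of_real (\<rho> q)) p)"

definition unit_cgrad :: "(complex^'n \<Rightarrow> real) \<Rightarrow> complex^'n \<Rightarrow> complex^'n" where
  "unit_cgrad \<rho> p = inverse (norm10 (cgrad \<rho> p)) *\<^sub>R cgrad \<rho> p"

definition complex_hess :: "(complex^'n \<Rightarrow> real) \<Rightarrow> complex^'n \<Rightarrow> complex^'n \<Rightarrow> complex" where
  "complex_hess f p X =
     (\<Sum>i\<in>UNIV. \<Sum>j\<in>UNIV.
        dz i (dzbar j (\<lambda>q. complex_of_real (f q))) p * X $ i * cnj (X $ j))"

subsection \<open>Pseudoconvexity\<close>

text \<open>\<open>T\<^sup>1\<^sup>,\<^sup>0\<^sub>p(\<partial>\<Omega>)\<close>, for \<open>p\<close> in the smooth boundary of \<open>\<Omega>\<close>: the complexified tangent space of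
  \<open>\<partial>\<Omega>\<close> is the kernel of the differential of the signed distance.\<close>

definition tangent10 :: "(complex^'n) set \<Rightarrow> complex^'n \<Rightarrow> (complex^'n) set" where
  "tangent10 \<Omega> p = {X. vec_deriv X (\<lambda>q. complex_of_real (signed_dist \<Omega> q)) p = 0}"

definition pseudoconvex :: "(complex^'n) set \<Rightarrow> bool" where
  "pseudoconvex \<Omega> \<longleftrightarrow>
     (\<forall>p\<in>frontier \<Omega>. \<forall>X\<in>tangent10 \<Omega> p. complex_hess (signed_dist \<Omega>) p X \<ge> 0)"

definition null_set ::
  "(complex^'n) set \<Rightarrow> (complex^'n) set \<Rightarrow> (complex^'n \<Rightarrow> complex^'n) \<Rightarrow> (complex^'n) set" where
  "null_set \<Omega> U L =
     {p \<in> U \<inter> frontier \<Omega>. complex_hess (signed_dist \<Omega>) p (L p) = 0}"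

end

theory Submission
  imports Defs
begin

text \<open>
  Write \<open>\<delta>\<^sub>i\<close>, \<open>\<delta>\<^bsub>i*\<^esub>\<close> for the derivatives of \<open>\<delta>\<close> along \<open>\<partial>/\<partial>z\<^sup>i\<close> and its conjugate. Near the boundary \<open>\<delta>\<close> is
  smooth and its gradient has length one, which reads \<open>\<Sum>\<^sub>i \<delta>\<^sub>i \<delta>\<^bsub>i*\<^esub> = 1/4\<close>. Hence
  \<open>N = sqrt 8 \<Sum>\<^sub>i \<delta>\<^bsub>i*\<^esub> \<partial>/\<partial>z\<^sup>i\<close>, and with \<open>\<beta>\<^sub>i = \<Sum>\<^sub>k L\<^sup>k \<delta>\<^bsub>ki*\<^esub>\<close> and
  \<open>\<tau> = \<Sum> \<delta>\<^bsub>i*\<^esub> \<delta>\<^bsub>ikj*\<^esub> L\<^sup>k cnj L\<^sup>j\<close> the product rule turns the quantity to be bounded into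
  \<open>4 (|\<beta>|\<^sup>2 + \<tau>)\<close> (\<open>herm10_cov_deriv\<close>). The third derivatives are controlled by the eikonal equation
  alone: applying \<open>\<partial>/\<partial>z\<^sup>k\<close> and the conjugate of \<open>\<partial>/\<partial>z\<^sup>j\<close> to it and contracting with \<open>L\<^sup>k cnj L\<^sup>j\<close> gives
  \<open>2 Re \<tau> + |\<alpha>|\<^sup>2 + |\<beta>|\<^sup>2 = 0\<close> with \<open>\<alpha>\<^sub>i = \<Sum>\<^sub>k L\<^sup>k \<delta>\<^bsub>ki\<^esub>\<close> (\<open>second_order_relation\<close>). If \<open>\<tau>\<close> is real, the
  quantity is therefore \<open>2 (|\<beta>|\<^sup>2 - |\<alpha>|\<^sup>2)\<close>, and it remains to see that \<open>|\<beta>| \<le> |\<alpha>|\<close> and that \<open>\<tau>\<close> is real.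
  Both are consequences of Levi pseudoconvexity and of \<open>Hess(L, L) = 0\<close> at the point.

  For the first, \<open>L\<close> is a null vector of a positive semidefinite form on the complex tangent space, so
  \<open>Hess(L, \<cdot>)\<close> vanishes on that space and \<open>\<beta>\<close> is a multiple of the complex gradient
  (\<open>hess11_null_vector\<close>). The eikonal equation differentiated once along \<open>L\<close> says that the gradient
  components of \<open>\<alpha>\<close> and \<open>\<beta>\<close> are opposite (\<open>first_order_relation\<close>). So \<open>|\<beta>|\<close> is the length of one
  component of \<open>\<alpha>\<close>.

  For the second, \<open>Hess(L, L)\<close> is real, nonnegative on the boundary and zero at the point, so its
  derivatives in boundary directions vanish there. In particular its derivative along \<open>\<i>\<close> times the
  normal vanishes, and the derivative along the complex gradient is real. By \<open>L\<delta> = 0\<close> this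
  derivative equals \<open>\<tau>\<close>: the two terms in which \<open>L\<close> is differentiated are \<open>4|\<gamma>|\<^sup>2\<close> and
  \<open>-4|\<gamma>|\<^sup>2\<close>, where \<open>\<gamma> = \<Sum>\<^sub>i \<beta>\<^sub>i \<delta>\<^sub>i\<close> (\<open>normal_derivative_complex_hess\<close>).

  Smoothness of \<open>\<delta>\<close> near the boundary comes from a defining function \<open>\<rho>\<close>. The nearest boundary point
  \<open>y\<close> of \<open>x\<close> solves \<open>y + s \<nabla>\<rho>(y) = x\<close>, \<open>\<rho>(y) = 0\<close> for some \<open>s\<close>, a system with invertible
  differential at \<open>s = 0\<close>. Its solution depends smoothly on \<open>x\<close> by the inverse function theorem, and
  \<open>\<delta>(x) = s |\<nabla>\<rho>(y)|\<close> (\<open>signed_dist_smooth\<close>).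
\<close>

section \<open>Calculus of C^k maps\<close>

lemma continuously_diff_on_cong:
  assumes "open S" "\<And>x. x \<in> S \<Longrightarrow> f x = g x"
  shows "continuously_diff_on k S f \<longleftrightarrow> continuously_diff_on k S g"
  using assms(2)
proof (induction k arbitrary: f g)
  case 0
  then show ?case by (auto cong: continuous_on_cong)
next
  case (Suc k)
  have diff: "f differentiable (at x) \<longleftrightarrow> g differentiable (at x)" if "x \<in> S" for x
    using has_derivative_transform_within_open[OF _ \<open>open S\<close> that] Suc.prems
    unfolding differentiable_def by metis
  have "frechet_derivative f (at x) = frechet_derivative g (at x)" if "x \<in> S" for x
  proof -
    have "(f has_derivative f') (at x) \<longleftrightarrow> (g has_derivative f') (at x)" for f'
      using has_derivative_transform_within_open[OF _ \<open>open S\<close> that] Suc.prems by metis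
    then show ?thesis unfolding frechet_derivative_def by simp
  qed
  then have "continuously_diff_on k S (\<lambda>x. frechet_derivative f (at x) v)
      \<longleftrightarrow> continuously_diff_on k S (\<lambda>x. frechet_derivative g (at x) v)" for v
    by (intro Suc.IH) auto
  with diff show ?case by simp
qed

text \<open>
  The definition speaks of \<open>frechet_derivative\<close>; this rule lets any explicit formula for the
  derivative stand in for it.
\<close>

lemma continuously_diff_on_SucI:
  assumes "open S" "\<And>x. x \<in> S \<Longrightarrow> (f has_derivative f' x) (at x)"
    and "\<And>v. continuously_diff_on k S (\<lambda>x. f' x v)"
  shows "continuously_diff_on (Suc k) S f"
proof -
  have "frechet_derivative f (at x) = f' x" if "x \<in> S" for x
    using assms(2)[OF that] by (metis frechet_derivative_at)
  then have "continuously_diff_on k S (\<lambda>x. frechet_derivative f (at x) v)" for v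
    using assms(3)[of v] continuously_diff_on_cong[OF assms(1)] by (smt (verit) )
  then show ?thesis using assms(2) by (auto simp: differentiable_def)
qed

lemma continuously_diff_on_SucD:
  assumes "continuously_diff_on (Suc k) S f"
  shows "x \<in> S \<Longrightarrow> (f has_derivative frechet_derivative f (at x)) (at x)"
    and "continuously_diff_on k S (\<lambda>x. frechet_derivative f (at x) v)"
  using assms by (auto simp: frechet_derivative_works)

lemma continuously_diff_on_subset:
  "continuously_diff_on k S f \<Longrightarrow> T \<subseteq> S \<Longrightarrow> continuously_diff_on k T f"
  by (induction k arbitrary: f) (auto intro: continuous_on_subset)

lemma continuously_diff_on_imp_continuous_on:
  "continuously_diff_on k S f \<Longrightarrow> continuous_on S f"
  by (cases k) (auto intro!: continuous_at_imp_continuous_on differentiable_imp_continuous_within)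

lemma continuously_diff_on_Suc_imp:
  "continuously_diff_on (Suc k) S f \<Longrightarrow> continuously_diff_on k S f"
proof (induction k arbitrary: f)
  case 0
  then show ?case using continuously_diff_on_imp_continuous_on[OF 0] by simp
next
  case (Suc k)
  then show ?case by (metis continuously_diff_on.simps(2))
qed

lemma continuously_diff_on_const: "open S \<Longrightarrow> continuously_diff_on k S (\<lambda>x. c)"
  by (induction k arbitrary: c) auto

lemma continuously_diff_on_bounded_linear:
  assumes "bounded_linear h" "open S" "continuously_diff_on k S f"
  shows "continuously_diff_on k S (\<lambda>x. h (f x))"
  using assms(3)
proof (induction k arbitrary: f)
  case 0
  then show ?case using assms by (auto intro: bounded_linear.continuous_on)
next
  case (Suc k)
  show ?case
    by (rule continuously_diff_on_SucI[OF assms(2)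
          bounded_linear.has_derivative[OF assms(1) continuously_diff_on_SucD(1)[OF Suc.prems]]])
       (auto intro: Suc.IH continuously_diff_on_SucD(2)[OF Suc.prems])
qed

lemma continuously_diff_on_ident: "open S \<Longrightarrow> continuously_diff_on k S (\<lambda>x. x)"
proof (induction k)
  case (Suc k)
  show ?case
    by (rule continuously_diff_on_SucI[where f' = "\<lambda>_ v. v"]) (auto intro: Suc continuously_diff_on_const)
qed simp

lemma continuously_diff_on_linear_map:
  "bounded_linear h \<Longrightarrow> open S \<Longrightarrow> continuously_diff_on k S h"
  using continuously_diff_on_bounded_linear[OF _ _ continuously_diff_on_ident] by blast

lemma continuously_diff_on_add:
  assumes "open S" "continuously_diff_on k S f" "continuously_diff_on k S g"
  shows "continuously_diff_on k S (\<lambda>x. f x + g x)"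
  using assms(2,3)
proof (induction k arbitrary: f g)
  case 0
  then show ?case by (auto intro: continuous_on_add)
next
  case (Suc k)
  show ?case
    by (rule continuously_diff_on_SucI[OF assms(1) has_derivative_add[OF
          continuously_diff_on_SucD(1)[OF Suc.prems(1)] continuously_diff_on_SucD(1)[OF Suc.prems(2)]]])
       (auto intro: Suc.IH continuously_diff_on_SucD(2)[OF Suc.prems(1)]
          continuously_diff_on_SucD(2)[OF Suc.prems(2)])
qed

lemma continuously_diff_on_minus:
  assumes "open S" "continuously_diff_on k S f"
  shows "continuously_diff_on k S (\<lambda>x. - f x)"
  using continuously_diff_on_bounded_linear[OF bounded_linear_minus[OF bounded_linear_ident] assms] .

lemma continuously_diff_on_sum:
  assumes "open S" "\<And>i. i \<in> I \<Longrightarrow> continuously_diff_on k S (f i)"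
  shows "continuously_diff_on k S (\<lambda>x. \<Sum>i\<in>I. f i x)"
  using assms(2)
  by (induction I rule: infinite_finite_induct)
     (auto intro: continuously_diff_on_const continuously_diff_on_add assms(1))

lemma continuously_diff_on_bilinear:
  assumes "bounded_bilinear pr" "open S" "continuously_diff_on k S f" "continuously_diff_on k S g"
  shows "continuously_diff_on k S (\<lambda>x. pr (f x) (g x))"
  using assms(3,4)
proof (induction k arbitrary: f g)
  case 0
  then show ?case using assms by (auto intro: bounded_bilinear.continuous_on)
next
  case (Suc k)
  show ?case
    by (rule continuously_diff_on_SucI[OF assms(2) bounded_bilinear.FDERIV[OF assms(1)
          continuously_diff_on_SucD(1)[OF Suc.prems(1)] continuously_diff_on_SucD(1)[OF Suc.prems(2)]]])
       (auto intro!: continuously_diff_on_add Suc.IH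
          continuously_diff_on_SucD(2)[OF Suc.prems(1)] continuously_diff_on_SucD(2)[OF Suc.prems(2)]
          continuously_diff_on_Suc_imp[OF Suc.prems(1)] continuously_diff_on_Suc_imp[OF Suc.prems(2)]
          assms(2))
qed

lemmas continuously_diff_on_scaleR = continuously_diff_on_bilinear[OF bounded_bilinear_scaleR]
lemmas continuously_diff_on_mult = continuously_diff_on_bilinear[OF bounded_bilinear_mult]
lemmas continuously_diff_on_inner = continuously_diff_on_bilinear[OF bounded_bilinear_inner]

lemma linear_Basis_expansion:
  fixes f :: "'a::euclidean_space \<Rightarrow> 'b::real_vector"
  assumes "linear f"
  shows "f w = (\<Sum>b\<in>Basis. (w \<bullet> b) *\<^sub>R f b)"
proof -
  have "f w = f (\<Sum>b\<in>Basis. (w \<bullet> b) *\<^sub>R b)"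
    by (simp add: euclidean_representation)
  also have "\<dots> = (\<Sum>b\<in>Basis. (w \<bullet> b) *\<^sub>R f b)"
    by (simp add: linear_sum[OF assms] linear_scale[OF assms] o_def)
  finally show ?thesis .
qed

text \<open>
  Expanding the inner derivative in a basis writes the chain rule as a sum of products of a derivative
  of \<open>f\<close> with \<open>g'(\<cdot>) b \<circ> f\<close> for fixed \<open>b\<close>. These are again compositions with the same \<open>f\<close>, so the
  induction only has to generalise over \<open>g\<close>.
\<close>

lemma continuously_diff_on_compose:
  fixes f :: "'a::euclidean_space \<Rightarrow> 'b::euclidean_space" and g :: "'b \<Rightarrow> 'c::real_normed_vector"
  assumes "open S" "f ` S \<subseteq> T" "continuously_diff_on k S f" "continuously_diff_on k T g"
  shows "continuously_diff_on k S (\<lambda>x. g (f x))"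
  using assms(3,4)
proof (induction k arbitrary: g)
  case 0
  then show ?case using assms(2) by (auto intro: continuous_on_compose2)
next
  case (Suc k)
  let ?Df = "\<lambda>x. frechet_derivative f (at x)" and ?Dg = "\<lambda>y. frechet_derivative g (at y)"
  have der: "(g has_derivative ?Dg y) (at y)" if "y \<in> T" for y
    using continuously_diff_on_SucD(1)[OF Suc.prems(2) that] .
  have "((\<lambda>x. g (f x)) has_derivative (\<lambda>v. \<Sum>b\<in>Basis. (?Df x v \<bullet> b) *\<^sub>R ?Dg (f x) b)) (at x)"
    if "x \<in> S" for x
  proof -
    have y: "f x \<in> T" using that assms(2) by auto
    have "((\<lambda>x. g (f x)) has_derivative (\<lambda>v. ?Dg (f x) (?Df x v))) (at x)"
      using has_derivative_compose[OF continuously_diff_on_SucD(1)[OF Suc.prems(1) that] der[OF y]] .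
    moreover have "linear (?Dg (f x))"
      using der[OF y] by (rule has_derivative_linear)
    ultimately show ?thesis by (simp add: linear_Basis_expansion[symmetric])
  qed
  then show ?case
  proof (rule continuously_diff_on_SucI[OF assms(1)])
    fix v
    show "continuously_diff_on k S (\<lambda>x. \<Sum>b\<in>Basis. (?Df x v \<bullet> b) *\<^sub>R ?Dg (f x) b)"
      by (intro continuously_diff_on_sum continuously_diff_on_scaleR continuously_diff_on_inner
          continuously_diff_on_const assms(1) Suc.IH continuously_diff_on_SucD(2)[OF Suc.prems(1)]
          continuously_diff_on_SucD(2)[OF Suc.prems(2)] continuously_diff_on_Suc_imp[OF Suc.prems(1)])
  qed
qed

text \<open>
  Inversion and the square root have derivatives that are rational in the functions themselves, so
  each regularity step follows from the previous one. They are needed for the length of the gradient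
  of a defining function.
\<close>

lemma continuously_diff_on_inverse_real:
  assumes "0 \<notin> S" "open S"
  shows "continuously_diff_on k S (inverse :: real \<Rightarrow> real)"
proof (induction k)
  case 0
  then show ?case using assms(1) by (auto intro!: continuous_on_inverse)
next
  case (Suc k)
  have "(inverse has_derivative (\<lambda>v. - (inverse x * v * inverse x))) (at x)" if "x \<in> S" for x :: real
    by (rule has_derivative_inverse') (use that assms in auto)
  then show ?case
    by (rule continuously_diff_on_SucI[OF assms(2)])
       (auto intro!: continuously_diff_on_minus continuously_diff_on_mult Suc continuously_diff_on_const assms(2))
qed

lemma continuously_diff_on_sqrt: "continuously_diff_on k {0<..} sqrt"
proof (induction k)
  case 0
  then show ?case by (auto intro!: continuous_intros)
next
  case (Suc k)
  have der: "(sqrt has_derivative (\<lambda>v. inverse (sqrt x) / 2 * v)) (at x)" if "x \<in> {0<..}" for x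
    using DERIV_real_sqrt[of x] that unfolding has_field_derivative_def
    by (simp del: times_divide_eq_left)
  have "continuously_diff_on k {0<..} (\<lambda>x. inverse (sqrt x))"
    by (rule continuously_diff_on_compose[OF _ _ Suc continuously_diff_on_inverse_real[of "{0<..}"]]) auto
  then have "continuously_diff_on k {0<..} (\<lambda>x. inverse (sqrt x) / 2 * v)" for v
    unfolding divide_inverse
    by (intro continuously_diff_on_mult continuously_diff_on_const) auto
  then show ?case
    using continuously_diff_on_SucI[OF open_greaterThan der] by blast
qed

lemma continuously_diff_on_norm:
  fixes f :: "'a::euclidean_space \<Rightarrow> 'b::euclidean_space"
  assumes "open S" "continuously_diff_on k S f" "\<And>x. x \<in> S \<Longrightarrow> f x \<noteq> 0"
  shows "continuously_diff_on k S (\<lambda>x. norm (f x))"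
  unfolding norm_eq_sqrt_inner
  by (rule continuously_diff_on_compose[OF assms(1) _ _ continuously_diff_on_sqrt])
     (use assms in \<open>auto intro!: continuously_diff_on_inner\<close>)

lemma continuously_diff_on_Pair:
  fixes f :: "'a::euclidean_space \<Rightarrow> 'b::real_normed_vector" and g :: "'a \<Rightarrow> 'c::real_normed_vector"
  assumes "open S" "continuously_diff_on k S f" "continuously_diff_on k S g"
  shows "continuously_diff_on k S (\<lambda>x. (f x, g x))"
proof -
  have l1: "bounded_linear (\<lambda>u::'b. (u, 0::'c))"
    by (intro bounded_linear_Pair bounded_linear_ident bounded_linear_zero)
  have l2: "bounded_linear (\<lambda>u::'c. (0::'b, u))"
    by (intro bounded_linear_Pair bounded_linear_ident bounded_linear_zero)
  have "continuously_diff_on k S (\<lambda>x. (f x, 0) + (0, g x))"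
    using continuously_diff_on_bounded_linear[OF l1 assms(1,2)]
      continuously_diff_on_bounded_linear[OF l2 assms(1,3)] continuously_diff_on_add[OF assms(1)] by blast
  then show ?thesis by simp
qed

lemma smooth_on_frechet_derivative:
  "smooth_on S f \<Longrightarrow> smooth_on S (\<lambda>x. frechet_derivative f (at x) v)"
  unfolding smooth_on_def using continuously_diff_on_SucD(2) by blast

lemma smooth_on_has_derivative:
  "smooth_on S f \<Longrightarrow> x \<in> S \<Longrightarrow> (f has_derivative frechet_derivative f (at x)) (at x)"
  unfolding smooth_on_def using continuously_diff_on_SucD(1) by blast

section \<open>Smooth inverse functions\<close>

text \<open>
  At a zero of \<open>\<phi>\<close> the second factor only has to be continuous: \<open>\<phi>\<close> is \<open>O(|y - x|)\<close>, so replacing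
  \<open>g y\<close> by \<open>g x\<close> costs \<open>o(|y - x|)\<close>. This is what makes the inverse of a family of operators
  differentiable once it is known to be continuous.
\<close>

lemma has_derivative_vanishing_scaleR:
  fixes \<phi> :: "'a::real_normed_vector \<Rightarrow> real" and g :: "'a \<Rightarrow> 'b::real_normed_vector"
  assumes "(\<phi> has_derivative \<phi>') (at x)" "\<phi> x = 0" "continuous (at x) g"
  shows "((\<lambda>y. \<phi> y *\<^sub>R g y) has_derivative (\<lambda>u. \<phi>' u *\<^sub>R g x)) (at x)"
proof -
  have bl: "bounded_linear \<phi>'" using assms(1) by (rule has_derivative_bounded_linear)
  obtain K where K: "eventually (\<lambda>y. norm (\<phi> y / norm (y - x)) \<le> K) (at x)"
  proof -
    obtain C where C: "\<And>u. norm (\<phi>' u) \<le> norm u * C"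
      using bl bounded_linear.bounded by blast
    have "((\<lambda>y. (\<phi> y - \<phi> x - \<phi>' (y - x)) /\<^sub>R norm (y - x)) \<longlongrightarrow> 0) (at x)"
      using assms(1) unfolding has_derivative_at2 by (simp add: diff_diff_eq divide_inverse_commute)
    then have "eventually (\<lambda>y. norm ((\<phi> y - \<phi> x - \<phi>' (y - x)) /\<^sub>R norm (y - x)) < 1) (at x)"
      by (auto simp: tendsto_iff dist_norm)
    then have "eventually (\<lambda>y. norm (\<phi> y / norm (y - x)) \<le> 1 + C) (at x)"
    proof (rule eventually_elim2[OF _ eventually_neq_at_within])
      fix y assume 1: "norm ((\<phi> y - \<phi> x - \<phi>' (y - x)) /\<^sub>R norm (y - x)) < 1" and ne: "y \<noteq> x"
      have "\<bar>\<phi> y\<bar> \<le> \<bar>\<phi> y - \<phi>' (y - x)\<bar> + \<bar>\<phi>' (y - x)\<bar>" by linarith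
      also have "\<dots> \<le> norm (y - x) + norm (y - x) * C"
        using 1 ne C[of "y - x"] assms(2) by (intro add_mono) (auto simp: field_simps)
      finally show "norm (\<phi> y / norm (y - x)) \<le> 1 + C"
        using ne by (simp add: field_simps)
    qed
    then show ?thesis using that by blast
  qed
  have lim0: "((\<lambda>y. g y - g x) \<longlongrightarrow> 0) (at x)"
    using assms(3) by (simp add: continuous_at Lim_null[symmetric])
  have "((\<lambda>y. (\<phi> y / norm (y - x)) *\<^sub>R (g y - g x)) \<longlongrightarrow> 0) (at x)"
  proof (rule Lim_null_comparison[rotated])
    show "((\<lambda>y. K * norm (g y - g x)) \<longlongrightarrow> 0) (at x)"
      using tendsto_mult_right_zero[OF tendsto_norm_zero[OF lim0]] .
    show "\<forall>\<^sub>F y in at x. norm ((\<phi> y / norm (y - x)) *\<^sub>R (g y - g x)) \<le> K * norm (g y - g x)"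
      using K by eventually_elim (unfold norm_scaleR real_norm_def, rule mult_right_mono, simp_all)
  qed
  moreover have "((\<lambda>y. \<phi> y *\<^sub>R g x) has_derivative (\<lambda>u. \<phi>' u *\<^sub>R g x)) (at x)"
    using assms(1) by (rule has_derivative_scaleR_left)
  then have "((\<lambda>y. (\<phi> y *\<^sub>R g x - \<phi> x *\<^sub>R g x - \<phi>' (y - x) *\<^sub>R g x) /\<^sub>R norm (y - x)) \<longlongrightarrow> 0) (at x)"
    by (simp add: has_derivative_at2 diff_diff_eq inverse_eq_divide)
  ultimately have "((\<lambda>y. (\<phi> y / norm (y - x)) *\<^sub>R (g y - g x) + 
      (\<phi> y *\<^sub>R g x - \<phi> x *\<^sub>R g x - \<phi>' (y - x) *\<^sub>R g x) /\<^sub>R norm (y - x)) \<longlongrightarrow> 0) (at x)"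
    using tendsto_add by force
  moreover have "(\<phi> y / norm (y - x)) *\<^sub>R (g y - g x) + 
      (\<phi> y *\<^sub>R g x - \<phi> x *\<^sub>R g x - \<phi>' (y - x) *\<^sub>R g x) /\<^sub>R norm (y - x)
    = (\<phi> y *\<^sub>R g y - \<phi> x *\<^sub>R g x - \<phi>' (y - x) *\<^sub>R g x) /\<^sub>R norm (y - x)" for y
    by (simp add: algebra_simps divide_inverse)
  ultimately show ?thesis
    using bounded_linear_scaleR_const[OF bl] by (simp add: has_derivative_at2 diff_diff_eq inverse_eq_divide)
qed

text \<open>
  From \<open>B x v - B x0 v = B x ((A x0 - A x) (B x0 v))\<close>. For continuity, the operators \<open>B x\<close> are bounded
  near \<open>x0\<close>, because \<open>A x\<close> is close to \<open>A x0\<close>, which is bounded below. For the derivative, the argument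
  of \<open>B x\<close> on the right vanishes at \<open>x0\<close>. The result is \<open>B' = - B A' B\<close>, which involves \<open>B\<close> itself only
  in its undifferentiated form, so the regularity of \<open>A\<close> is inherited step by step.
\<close>

lemma continuously_diff_on_linear_inverse:
  fixes A B :: "'x::euclidean_space \<Rightarrow> 'b::euclidean_space \<Rightarrow> 'b"
  assumes "open S"
    and linA: "\<And>x. x \<in> S \<Longrightarrow> linear (A x)" and linB: "\<And>x. x \<in> S \<Longrightarrow> linear (B x)"
    and BA: "\<And>x w. x \<in> S \<Longrightarrow> B x (A x w) = w" and AB: "\<And>x w. x \<in> S \<Longrightarrow> A x (B x w) = w"
    and "\<And>w. continuously_diff_on k S (\<lambda>x. A x w)"
  shows "continuously_diff_on k S (\<lambda>x. B x v)"
  using assms(6)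
proof (induction k arbitrary: v)
  case 0
  have contA: "isCont (\<lambda>x. A x w) x" if "x \<in> S" for x w
    using 0[of w] that \<open>open S\<close> by (simp add: continuous_on_eq_continuous_at)
  have "isCont (\<lambda>x. B x v) x0" if x0: "x0 \<in> S" for x0
  proof -
    define w0 where "w0 = B x0 v"
    obtain K where K: "K > 0" "\<And>u. norm (B x0 u) \<le> norm u * K"
      using linB[OF x0] linear_conv_bounded_linear bounded_linear.pos_bounded by blast
    have low: "norm w \<le> norm (A x0 w) * K" for w
      using K(2)[of "A x0 w"] BA[OF x0] by simp
    have "((\<lambda>x. \<Sum>b\<in>Basis. norm (A x b - A x0 b)) \<longlongrightarrow> (\<Sum>b\<in>(Basis::'b set). norm (A x0 b - A x0 b))) (at x0)"
      using contA[OF x0] by (intro tendsto_intros) (auto simp: isCont_def)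
    then have "eventually (\<lambda>x. (\<Sum>b\<in>Basis. norm (A x b - A x0 b)) < 1 / (2 * K)) (at x0)"
      using K by (auto simp: order_tendsto_iff)
    moreover have ev_S: "eventually (\<lambda>x. x \<in> S) (at x0)"
      using x0 \<open>open S\<close> by (simp add: eventually_at_in_open')
    ultimately have "eventually (\<lambda>x. norm (B x v - B x0 v) \<le> 2 * K * norm (A x0 w0 - A x w0)) (at x0)"
    proof eventually_elim
      case (elim x)
      have diff: "norm (A x w - A x0 w) \<le> norm w * (1 / (2 * K))" for w
      proof -
        have "A x w - A x0 w = (\<Sum>b\<in>Basis. (w \<bullet> b) *\<^sub>R (A x b - A x0 b))"
          by (subst linear_Basis_expansion[OF linA[OF elim(2)]], subst linear_Basis_expansion[OF linA[OF x0]])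
             (simp add: sum_subtractf scaleR_diff_right)
        also have "norm \<dots> \<le> (\<Sum>b\<in>Basis. norm w * norm (A x b - A x0 b))"
          by (intro sum_norm_le) (auto intro!: mult_right_mono Basis_le_norm)
        also have "\<dots> \<le> norm w * (1 / (2 * K))"
          unfolding sum_distrib_left[symmetric] using elim(1) by (intro mult_left_mono) auto
        finally show ?thesis .
      qed
      define u where "u = A x0 w0 - A x w0"
      have eq: "B x u = B x v - B x0 v"
        unfolding u_def w0_def using linear_diff[OF linB[OF elim(2)]] AB[OF x0] BA[OF elim(2)] by simp
      have "norm (B x u) \<le> norm (A x0 (B x u)) * K" by (rule low)
      also have "norm (A x0 (B x u)) \<le> norm (A x (B x u)) + norm (A x (B x u) - A x0 (B x u))"
        by (metis norm_minus_commute norm_triangle_sub)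
      also have "\<dots> \<le> norm u + norm (B x u) * (1 / (2 * K))"
        using diff[of "B x u"] AB[OF elim(2), of u] by simp
      finally have "norm (B x u) \<le> norm u * K + norm (B x u) / 2"
        using K(1) by (simp add: field_simps)
      then have "norm (B x u) \<le> 2 * K * norm u" by (simp add: algebra_simps)
      then show ?case using eq unfolding u_def by simp
    qed
    moreover have "((\<lambda>x. 2 * K * norm (A x0 w0 - A x w0)) \<longlongrightarrow> 2 * K * norm (A x0 w0 - A x0 w0)) (at x0)"
      using contA[OF x0, of w0] unfolding isCont_def by (intro tendsto_intros)
    then have "((\<lambda>x. 2 * K * norm (A x0 w0 - A x w0)) \<longlongrightarrow> 0) (at x0)"
      by simp
    ultimately have "((\<lambda>x. B x v - B x0 v) \<longlongrightarrow> 0) (at x0)"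
      by (rule Lim_null_comparison)
    then show ?thesis unfolding isCont_def by (simp only: Lim_null[symmetric])
  qed
  then show ?case by (auto intro: continuous_at_imp_continuous_on)
next
  case (Suc k)
  let ?DA = "\<lambda>x w u. frechet_derivative (\<lambda>x. A x w) (at x) u"
  have IH: "continuously_diff_on k S (\<lambda>x. B x v)" for v
    by (rule Suc.IH) (rule continuously_diff_on_Suc_imp[OF Suc.prems])
  have contB: "isCont (\<lambda>x. B x v) x" if "x \<in> S" for x v
    using continuously_diff_on_imp_continuous_on[OF IH] that \<open>open S\<close> by (simp add: continuous_on_eq_continuous_at)
  let ?D = "\<lambda>x u. \<Sum>b\<in>Basis. - ((\<Sum>c\<in>Basis. (B x v \<bullet> c) * (?DA x c u \<bullet> b))) *\<^sub>R B x b"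
  have "((\<lambda>x. B x v) has_derivative ?D x0) (at x0)" if x0: "x0 \<in> S" for x0
  proof -
    define w0 where "w0 = B x0 v"
    let ?\<phi> = "\<lambda>b x. (v - (\<Sum>c\<in>Basis. (w0 \<bullet> c) *\<^sub>R A x c)) \<bullet> b"
    have Aw0: "A x w0 = (\<Sum>c\<in>Basis. (w0 \<bullet> c) *\<^sub>R A x c)" if "x \<in> S" for x
      by (rule linear_Basis_expansion[OF linA[OF that]])
    have "(?\<phi> b has_derivative (\<lambda>u. - (\<Sum>c\<in>Basis. (w0 \<bullet> c) * (?DA x0 c u \<bullet> b)))) (at x0)" for b
    proof -
      have "(?\<phi> b has_derivative (\<lambda>u. (0 - (\<Sum>c\<in>Basis. (w0 \<bullet> c) *\<^sub>R ?DA x0 c u)) \<bullet> b)) (at x0)"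
        by (intro derivative_intros continuously_diff_on_SucD(1)[OF Suc.prems x0])
      then show ?thesis by (simp add: inner_sum_left)
    qed
    then have "((\<lambda>x. ?\<phi> b x *\<^sub>R B x b) has_derivative
        (\<lambda>u. - (\<Sum>c\<in>Basis. (w0 \<bullet> c) * (?DA x0 c u \<bullet> b)) *\<^sub>R B x0 b)) (at x0)" for b
      by (rule has_derivative_vanishing_scaleR[OF _ _ contB[OF x0]])
         (subst Aw0[OF x0, symmetric], unfold w0_def AB[OF x0], simp)
    then have "((\<lambda>x. w0 + (\<Sum>b\<in>Basis. ?\<phi> b x *\<^sub>R B x b)) has_derivative (\<lambda>u. 0 + ?D x0 u)) (at x0)"
      unfolding w0_def[symmetric] by (intro has_derivative_add has_derivative_sum has_derivative_const) 
    moreover have "w0 + (\<Sum>b\<in>Basis. ?\<phi> b x *\<^sub>R B x b) = B x v" if "x \<in> S" for x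
    proof -
      have "(\<Sum>b\<in>Basis. ?\<phi> b x *\<^sub>R B x b) = B x (v - A x w0)"
        unfolding Aw0[OF that, symmetric] by (rule linear_Basis_expansion[OF linB[OF that], symmetric])
      also have "\<dots> = B x v - w0"
        using linear_diff[OF linB[OF that]] BA[OF that] by simp
      finally show ?thesis by simp
    qed
    ultimately show ?thesis
      using has_derivative_transform_within_open[OF _ \<open>open S\<close> x0] by fastforce
  qed
  then show ?case
  proof (rule continuously_diff_on_SucI[OF \<open>open S\<close>])
    fix u
    show "continuously_diff_on k S (\<lambda>x. ?D x u)"
      by (intro continuously_diff_on_sum continuously_diff_on_scaleR continuously_diff_on_minus
          continuously_diff_on_mult continuously_diff_on_inner continuously_diff_on_const IH
          continuously_diff_on_SucD(2)[OF Suc.prems] \<open>open S\<close>)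
  qed
qed

text \<open>
  The local inverse \<open>g\<close> is differentiable with \<open>g' = (G' \<circ> g)\<^sup>-\<^sup>1\<close>. If \<open>g\<close> is \<open>C\<^sup>k\<close>, so is the
  right-hand side, hence \<open>g\<close> is \<open>C\<^sup>k\<^sup>+\<^sup>1\<close>.
\<close>

lemma smooth_inverse_function_theorem:
  fixes G :: "'b::euclidean_space \<Rightarrow> 'b"
  assumes "open S" "smooth_on S G" "x0 \<in> S"
    and inj: "\<And>w. frechet_derivative G (at x0) w = 0 \<Longrightarrow> w = 0"
  obtains U V g where "open U" "U \<subseteq> S" "x0 \<in> U" "open V" "homeomorphism U V G g" "smooth_on V g"
proof -
  let ?D = "\<lambda>x. frechet_derivative G (at x)"
  have der: "(G has_derivative ?D x) (at x)" if "x \<in> S" for x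
    using assms(2) that by (rule smooth_on_has_derivative)
  then have bl: "bounded_linear (?D x)" if "x \<in> S" for x
    using that has_derivative_bounded_linear by blast
  define f' where "f' x = Blinfun (?D x)" for x
  have f': "blinfun_apply (f' x) = ?D x" if "x \<in> S" for x
    unfolding f'_def using bl[OF that] by (rule bounded_linear_Blinfun_apply)
  have smD: "continuously_diff_on k S (\<lambda>x. ?D x v)" for k v
    using smooth_on_frechet_derivative[OF assms(2)] unfolding smooth_on_def by blast
  have contf: "continuous_on S f'"
  proof (rule continuous_on_blinfun_componentwise)
    fix i :: 'b
    have "continuous_on S (\<lambda>x. ?D x i)"
      using smD continuously_diff_on_imp_continuous_on by blast
    then show "continuous_on S (\<lambda>x. blinfun_apply (f' x) i)"
      by (rule continuous_on_eq) (simp add: f')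
  qed
  have "inj (?D x0)"
    using inj bl[OF assms(3)] by (simp add: linear_injective_0 bounded_linear.linear)
  then obtain h where h: "linear h" "h \<circ> ?D x0 = id"
    using linear_injective_left_inverse bl[OF assms(3)] bounded_linear.linear by blast
  then have "Blinfun h o\<^sub>L f' x0 = id_blinfun"
    by (intro blinfun_eqI) (simp add: bounded_linear_Blinfun_apply linear_conv_bounded_linear f' assms(3)
         blinfun_apply_blinfun_compose pointfree_idE)
  then obtain U V g g' where *: "open U" "U \<subseteq> S" "x0 \<in> U" "open V" "homeomorphism U V G g"
    "\<And>y. y \<in> V \<Longrightarrow> (g has_derivative (g' y)) (at y)"
    "\<And>y. y \<in> V \<Longrightarrow> g' y = inv (blinfun_apply (f'(g y)))"
    "\<And>y. y \<in> V \<Longrightarrow> bij (blinfun_apply (f'(g y)))"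
    using inverse_function_theorem[OF assms(1) _ contf assms(3), of G "Blinfun h"] der f' by metis
  have gS: "g y \<in> S" if "y \<in> V" for y
    using *(2,5) that unfolding homeomorphism_def by blast
  have "continuously_diff_on k V g" for k
  proof (induction k)
    case 0
    then show ?case using *(5) by (simp add: homeomorphism_def)
  next
    case (Suc k)
    have "continuously_diff_on k V (\<lambda>y. g' y v)" for v
    proof (rule continuously_diff_on_linear_inverse[OF *(4), where A = "\<lambda>y. ?D (g y)"])
      fix y assume y: "y \<in> V"
      show "linear (?D (g y))" using bl[OF gS[OF y]] bounded_linear.linear by blast
      show "linear (g' y)" using *(6)[OF y] has_derivative_linear by blast
      show "g' y (?D (g y) w) = w" for w
        using *(7,8)[OF y] f'[OF gS[OF y]] by (simp add: bij_is_inj)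
      show "?D (g y) (g' y w) = w" for w
        using *(7,8)[OF y] f'[OF gS[OF y]] by (simp add: bij_is_surj surj_f_inv_f)
    next
      show "continuously_diff_on k V (\<lambda>y. ?D (g y) w)" for w
        by (rule continuously_diff_on_compose[OF *(4) _ Suc smD]) (use gS in auto)
    qed
    then show ?case
      using continuously_diff_on_SucI[OF *(4) *(6)] by blast
  qed
  then show ?thesis using that *(1-5) by (auto simp: smooth_on_def)
qed

section \<open>Nearest boundary points\<close>

lemma has_derivative_along_line:
  assumes "(f has_derivative f') (at y)"
  shows "((\<lambda>t. f (y + t *\<^sub>R w)) has_real_derivative f' w) (at 0)"
proof -
  interpret bounded_linear f' using assms by (rule has_derivative_bounded_linear)
  have "((\<lambda>t. f (y + t *\<^sub>R w)) has_derivative (\<lambda>t. f' (t *\<^sub>R w))) (at 0)"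
    by (rule has_derivative_compose[where g = f]) (use assms in \<open>auto intro!: derivative_eq_intros\<close>)
  then show ?thesis by (simp add: has_field_derivative_def scaleR mult_commute_abs)
qed

lemma derivative_le_if_growth_le:
  fixes f :: "'a::real_normed_vector \<Rightarrow> real"
  assumes "(f has_derivative f') (at y)" "0 < r" "\<And>t. 0 < t \<Longrightarrow> t < r \<Longrightarrow> f (y + t *\<^sub>R w) \<le> f y + t * c"
  shows "f' w \<le> c"
proof (rule ccontr)
  assume "\<not> f' w \<le> c"
  moreover have "((\<lambda>t. f (y + t *\<^sub>R w) - t * c) has_real_derivative f' w - c) (at 0)"
    using has_derivative_along_line[OF assms(1)] by (auto intro!: derivative_eq_intros)
  ultimately obtain d where "d > 0" "\<And>h. 0 < h \<Longrightarrow> h < d \<Longrightarrow> f y < f (y + h *\<^sub>R w) - h * c"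
    using DERIV_pos_inc_right[of "\<lambda>t. f (y + t *\<^sub>R w) - t * c" "f' w - c" 0] by auto
  moreover have "0 < min d r / 2" "min d r / 2 < d" "min d r / 2 < r"
    using \<open>d > 0\<close> \<open>0 < r\<close> by (auto simp: min_def)
  ultimately show False
    using assms(3)[of "min d r / 2"] by fastforce
qed

lemma eventually_increasing_direction:
  fixes f :: "'a::real_normed_vector \<Rightarrow> real"
  assumes "(f has_derivative f') (at y)" "0 < f' w"
  shows "\<forall>\<^sub>F t in at_right 0. f y < f (y + t *\<^sub>R w)"
proof -
  obtain d where "d > 0" "\<And>h. 0 < h \<Longrightarrow> h < d \<Longrightarrow> f y < f (y + h *\<^sub>R w)"
    using DERIV_pos_inc_right[OF has_derivative_along_line[OF assms(1)] assms(2)] by auto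
  then show ?thesis by (auto simp: eventually_at_right_field intro!: exI[of _ d])
qed

lemma eventually_at_right_in_open:
  fixes y :: "'a::real_normed_vector"
  assumes "open V" "y \<in> V"
  shows "\<forall>\<^sub>F t in at_right 0. y + t *\<^sub>R w \<in> V"
proof -
  have "((\<lambda>t. y + t *\<^sub>R w) \<longlongrightarrow> y + 0 *\<^sub>R w) (at_right 0)"
    by (intro tendsto_intros)
  then show ?thesis using assms by (auto dest: topological_tendstoD)
qed

text \<open>
  Multiplier rule: if the open half space in direction \<open>e\<close> contains no direction of increase of
  \<open>n\<close>, then the component of \<open>n\<close> orthogonal to \<open>e\<close> must vanish, since one can move along it after an
  arbitrarily small push by \<open>e\<close>.
\<close>

lemma opposite_if_disjoint_half_spaces:
  fixes n e :: "'a::real_inner"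
  assumes "e \<noteq> 0" "\<And>w. 0 < w \<bullet> e \<Longrightarrow> n \<bullet> w \<le> 0"
  shows "norm n *\<^sub>R e = - (norm e *\<^sub>R n)"
proof -
  define c where "c = (n \<bullet> e) / (e \<bullet> e)"
  define q where "q = n - c *\<^sub>R e"
  have ee: "e \<bullet> e > 0" using assms(1) by simp
  have qe: "q \<bullet> e = 0" using ee by (simp add: q_def c_def inner_diff_left)
  have c: "c \<le> 0" using assms(2)[of e] ee by (simp add: c_def divide_nonpos_pos)
  have "q \<bullet> q \<le> 0 + \<epsilon>" if "\<epsilon> > 0" for \<epsilon>
  proof -
    have pos: "\<bar>n \<bullet> e\<bar> + 1 > 0" by linarith
    let ?t = "\<epsilon> / (\<bar>n \<bullet> e\<bar> + 1)"
    have t: "?t > 0" using that pos by simp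
    then have "n \<bullet> (q + ?t *\<^sub>R e) \<le> 0"
      by (intro assms(2)) (use mult_pos_pos[OF t ee] in \<open>simp add: inner_add_left qe\<close>)
    then have "n \<bullet> q \<le> ?t * - (n \<bullet> e)" by (simp add: inner_add_right)
    also have "\<dots> \<le> ?t * (\<bar>n \<bullet> e\<bar> + 1)" using t by (intro mult_left_mono) auto
    also have "\<dots> = \<epsilon>" using pos by simp
    finally have "n \<bullet> q \<le> \<epsilon>" .
    moreover have "n = q + c *\<^sub>R e" by (simp add: q_def)
    then have "n \<bullet> q = q \<bullet> q" using qe by (simp add: inner_add_left inner_commute[of e])
    ultimately show ?thesis by simp
  qed
  then have "q \<bullet> q \<le> 0" by (rule field_le_epsilon)
  then have "q = 0" by (metis inner_gt_zero_iff not_less)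
  then have n: "n = c *\<^sub>R e" by (simp add: q_def)
  show ?thesis unfolding n using c by simp
qed

lemma abs_signed_dist: "\<bar>signed_dist \<Omega> x\<bar> = infdist x (frontier \<Omega>)"
  by (simp add: signed_dist_def infdist_nonneg)

text \<open>
  Two points on different sides of the boundary are joined by a segment that crosses it, and the
  crossing point bounds the sum of their distances.
\<close>

lemma signed_dist_lipschitz:
  fixes x y :: "'a::euclidean_space"
  shows "\<bar>signed_dist \<Omega> x - signed_dist \<Omega> y\<bar> \<le> dist x y"
proof -
  have cross: "infdist x (frontier \<Omega>) + infdist y (frontier \<Omega>) \<le> dist x y"
    if "x \<in> \<Omega>" "y \<notin> \<Omega>" for x y :: 'a
  proof -
    have "closed_segment x y \<inter> frontier \<Omega> \<noteq> {}"
    proof (rule connected_Int_frontier)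
      show "closed_segment x y \<inter> \<Omega> \<noteq> {}" using that(1) ends_in_segment(1)[of x y] by blast
      show "closed_segment x y - \<Omega> \<noteq> {}" using that(2) ends_in_segment(2)[of y x] by blast
    qed simp
    then obtain z where z: "z \<in> closed_segment x y" "z \<in> frontier \<Omega>" by blast
    then have "dist x y = dist x z + dist y z"
      using between[of x y z] by (simp add: between_mem_segment dist_commute)
    then show ?thesis using infdist_le[OF z(2), of x] infdist_le[OF z(2), of y] by linarith
  qed
  show ?thesis
    using cross[of x y] cross[of y x] infdist_triangle_abs[of x "frontier \<Omega>" y]
      infdist_nonneg[of x "frontier \<Omega>"] infdist_nonneg[of y "frontier \<Omega>"]
    by (auto simp: signed_dist_def dist_commute)
qed

lemma ball_infdist_frontier_one_side:
  fixes x :: "'a::euclidean_space"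
  shows "x \<in> \<Omega> \<Longrightarrow> ball x (infdist x (frontier \<Omega>)) \<subseteq> \<Omega>"
    and "x \<notin> \<Omega> \<Longrightarrow> ball x (infdist x (frontier \<Omega>)) \<inter> \<Omega> = {}"
proof -
  let ?B = "ball x (infdist x (frontier \<Omega>))"
  have no: "?B \<inter> frontier \<Omega> = {}"
    using infdist_le[of _ "frontier \<Omega>" x] by (force simp: not_le[symmetric])
  have "x \<in> ?B \<or> ?B = {}"
    by (metis ball_eq_empty centre_in_ball linorder_not_le)
  then show "x \<in> \<Omega> \<Longrightarrow> ?B \<subseteq> \<Omega>" "x \<notin> \<Omega> \<Longrightarrow> ?B \<inter> \<Omega> = {}"
    using no connected_Int_frontier[OF connected_ball, of x "infdist x (frontier \<Omega>)" \<Omega>] by blast+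
qed

text \<open>
  \<open>\<rho>\<close> is only assumed to describe \<open>\<Omega>\<close>. At a zero of \<open>\<rho>\<close>, moving against the gradient enters
  \<open>\<Omega>\<close>; where \<open>\<rho> > 0\<close>, a whole neighbourhood misses \<open>\<Omega>\<close>.
\<close>

lemma frontier_iff_defining_function_zero:
  fixes \<rho> :: "'a::euclidean_space \<Rightarrow> real"
  assumes "open \<Omega>" "open V" "\<Omega> \<inter> V = {q \<in> V. \<rho> q < 0}"
    and der: "(\<rho> has_derivative (\<lambda>v. n \<bullet> v)) (at y)" and "n \<noteq> 0" and "y \<in> V"
  shows "y \<in> frontier \<Omega> \<longleftrightarrow> \<rho> y = 0"
proof
  assume y: "y \<in> frontier \<Omega>"
  then have "y \<notin> \<Omega>" using assms(1) by (simp add: frontier_def interior_open)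
  then have "\<rho> y \<ge> 0" using assms(3,6) by force
  moreover have "\<not> \<rho> y > 0"
  proof
    assume "\<rho> y > 0"
    have "isCont \<rho> y" using der by (rule has_derivative_continuous)
    then have "\<forall>\<^sub>F z in nhds y. \<rho> z > 0"
      using \<open>\<rho> y > 0\<close> by (metis isCont_def order_tendstoD(1) tendsto_at_iff_tendsto_nhds)
    moreover have "\<forall>\<^sub>F z in nhds y. z \<in> V" using assms(2,6) by (rule eventually_nhds_in_open)
    ultimately have "\<forall>\<^sub>F z in nhds y. z \<notin> \<Omega>"
      by eventually_elim (use assms(3) in force)
    then obtain T where "open T" "y \<in> T" "T \<inter> \<Omega> = {}"
      by (auto simp: eventually_nhds)
    then have "y \<notin> closure \<Omega>" by (metis disjoint_iff open_Int_closure_eq_empty)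
    then show False using y by (simp add: frontier_def)
  qed
  ultimately show "\<rho> y = 0" by simp
next
  assume 0: "\<rho> y = 0"
  then have "y \<notin> \<Omega>" using assms(3,6) by force
  moreover have "y \<in> closure \<Omega>"
  proof -
    have "((\<lambda>z. - \<rho> z) has_derivative (\<lambda>v. - (n \<bullet> v))) (at y)"
      using der by (rule has_derivative_minus)
    then have "\<forall>\<^sub>F t in at_right 0. - \<rho> y < - \<rho> (y + t *\<^sub>R (- n))"
      by (rule eventually_increasing_direction) (use \<open>n \<noteq> 0\<close> in simp)
    then have "\<forall>\<^sub>F t in at_right 0. y + t *\<^sub>R (- n) \<in> closure \<Omega>"
      using eventually_at_right_in_open[OF assms(2,6), of "- n"]
    proof eventually_elim
      case (elim t)
      then have "y + t *\<^sub>R (- n) \<in> \<Omega> \<inter> V" unfolding assms(3) using 0 by simp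
      then show ?case using closure_subset by blast
    qed
    moreover have "((\<lambda>t. y + t *\<^sub>R (- n)) \<longlongrightarrow> y + 0 *\<^sub>R (- n)) (at_right 0)"
      by (intro tendsto_intros)
    ultimately show ?thesis
      using Lim_in_closed_set[OF closed_closure, of "\<lambda>t. y + t *\<^sub>R (- n)" \<Omega> "at_right (0::real)"] by simp
  qed
  ultimately show "y \<in> frontier \<Omega>" using assms(1) by (simp add: frontier_def interior_open)
qed

text \<open>
  The ball around \<open>x\<close> that touches the boundary at \<open>y\<close> lies on one side of it, so \<open>\<rho>\<close> has one sign on
  the ball and cannot increase (or decrease) into it from \<open>y\<close>. The multiplier rule then determines not
  only the line through \<open>x\<close> and \<open>y\<close> but also the sign, which is the one built into the signed
  distance.
\<close>

lemma nearest_point_normal: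
  fixes \<rho> :: "'a::euclidean_space \<Rightarrow> real"
  assumes "open \<Omega>" "open V" "\<Omega> \<inter> V = {q \<in> V. \<rho> q < 0}"
    and der: "(\<rho> has_derivative (\<lambda>v. n \<bullet> v)) (at y)" and "n \<noteq> 0"
    and "y \<in> V" "y \<in> frontier \<Omega>" and d: "dist x y = infdist x (frontier \<Omega>)"
  shows "x = y + (signed_dist \<Omega> x / norm n) *\<^sub>R n"
proof (cases "x = y")
  case True
  then show ?thesis using d by (simp add: signed_dist_def)
next
  case False
  define e where "e = x - y"
  have e: "e \<noteq> 0" "norm e = infdist x (frontier \<Omega>)"
    using False d by (auto simp: e_def dist_norm)
  have \<rho>0: "\<rho> y = 0"
    using frontier_iff_defining_function_zero[OF assms(1-6)] assms(7) by simp
  have in_ball: "\<forall>\<^sub>F t in at_right 0. y + t *\<^sub>R w \<in> ball x (infdist x (frontier \<Omega>)) \<inter> V" if "0 < w \<bullet> e" for w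
  proof -
    have "((\<lambda>z. - ((z - x) \<bullet> (z - x))) has_derivative (\<lambda>v. - ((y - x) \<bullet> v + v \<bullet> (y - x)))) (at y)"
      by (auto intro!: derivative_eq_intros)
    then have "\<forall>\<^sub>F t in at_right 0. - ((y - x) \<bullet> (y - x)) < - ((y + t *\<^sub>R w - x) \<bullet> (y + t *\<^sub>R w - x))"
      by (rule eventually_increasing_direction)
         (use that in \<open>simp add: e_def inner_commute inner_diff_left inner_diff_right\<close>)
    then show ?thesis using eventually_at_right_in_open[OF assms(2,6), of w]
    proof eventually_elim
      case (elim t)
      then have "(norm (y + t *\<^sub>R w - x))\<^sup>2 < (norm (y - x))\<^sup>2"
        by (simp add: power2_norm_eq_inner)
      then have "norm (y + t *\<^sub>R w - x) < norm (y - x)" by (rule power2_less_imp_less) simp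
      then show ?case using elim d by (simp add: dist_norm norm_minus_commute)
    qed
  qed
  have scaled: "u = (c / norm n) *\<^sub>R n" if "norm n *\<^sub>R u = c *\<^sub>R n" for u c
  proof -
    have "u = (1 / norm n) *\<^sub>R (norm n *\<^sub>R u)" using \<open>n \<noteq> 0\<close> by simp
    then show ?thesis unfolding that by simp
  qed
  have nt: "\<not> (\<forall>\<^sub>F t in at_right (0::real). False)"
    by (simp add: trivial_limit_at_right_real)
  show ?thesis
  proof (cases "x \<in> \<Omega>")
    case True
    have "n \<bullet> w \<le> 0" if w: "0 < w \<bullet> e" for w
    proof (rule ccontr)
      assume "\<not> n \<bullet> w \<le> 0"
      then have "\<forall>\<^sub>F t in at_right 0. \<rho> y < \<rho> (y + t *\<^sub>R w)"
        by (intro eventually_increasing_direction[OF der]) simp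
      then have "\<forall>\<^sub>F t in at_right (0::real). False"
        using in_ball[OF w]
        by eventually_elim (use ball_infdist_frontier_one_side(1)[OF True] assms(3) \<rho>0 in force)
      then show False using nt by simp
    qed
    then have "norm n *\<^sub>R e = - (norm e *\<^sub>R n)"
      by (rule opposite_if_disjoint_half_spaces[OF e(1)])
    then have "e = - (norm e / norm n) *\<^sub>R n"
      using scaled[of e "- norm e"] by simp
    then show ?thesis using True e(2) by (simp add: e_def signed_dist_def algebra_simps)
  next
    case out: False
    have "(- n) \<bullet> w \<le> 0" if w: "0 < w \<bullet> e" for w
    proof (rule ccontr)
      assume "\<not> (- n) \<bullet> w \<le> 0"
      then have "\<forall>\<^sub>F t in at_right 0. - \<rho> y < - \<rho> (y + t *\<^sub>R w)"
        by (intro eventually_increasing_direction[OF has_derivative_minus[OF der]]) simp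
      then have "\<forall>\<^sub>F t in at_right (0::real). False"
        using in_ball[OF w]
        by eventually_elim (use ball_infdist_frontier_one_side(2)[OF out] assms(3) \<rho>0 in force)
      then show False using nt by simp
    qed
    then have "norm (- n) *\<^sub>R e = - (norm e *\<^sub>R (- n))"
      by (rule opposite_if_disjoint_half_spaces[OF e(1)])
    then have "norm n *\<^sub>R e = norm e *\<^sub>R n" by simp
    then have "e = (norm e / norm n) *\<^sub>R n" by (rule scaled)
    then show ?thesis using out e(2) by (simp add: e_def signed_dist_def algebra_simps)
  qed
qed

section \<open>The signed distance near the boundary\<close>

lemma smooth_on_gradient:
  fixes f :: "'a::euclidean_space \<Rightarrow> real"
  assumes "open V" "smooth_on V f"
  obtains n where "\<And>k. continuously_diff_on k V n" "\<And>y. y \<in> V \<Longrightarrow> (f has_derivative (\<lambda>v. n y \<bullet> v)) (at y)"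
proof
  let ?n = "\<lambda>y. \<Sum>b\<in>Basis. frechet_derivative f (at y) b *\<^sub>R b"
  show "continuously_diff_on k V ?n" for k
    using smooth_on_frechet_derivative[OF assms(2)] unfolding smooth_on_def
    by (intro continuously_diff_on_sum continuously_diff_on_scaleR continuously_diff_on_const assms(1)) blast+
  fix y assume "y \<in> V"
  then have der: "(f has_derivative frechet_derivative f (at y)) (at y)"
    by (rule smooth_on_has_derivative[OF assms(2)])
  have "frechet_derivative f (at y) = (\<lambda>v. ?n y \<bullet> v)"
  proof
    show "frechet_derivative f (at y) v = ?n y \<bullet> v" for v
      using linear_Basis_expansion[OF has_derivative_linear[OF der], of v]
      by (simp add: inner_sum_left inner_commute[of v] mult.commute)
  qed
  then show "(f has_derivative (\<lambda>v. ?n y \<bullet> v)) (at y)" using der by simp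
qed

text \<open>
  Inverts \<open>G(y, s) = (y + s \<nabla>\<rho>(y), \<rho>(y))\<close> near \<open>(p, 0)\<close>. With the gradient left unnormalised, its length
  is differentiated only in the final formula \<open>\<delta>(x) = s |\<nabla>\<rho>(y)|\<close>.
\<close>

lemma signed_dist_smooth:
  fixes \<Omega> :: "'a::euclidean_space set"
  assumes "open \<Omega>" "smooth_boundary \<Omega>" "p \<in> frontier \<Omega>"
  obtains W where "open W" "p \<in> W" "smooth_on W (signed_dist \<Omega>)"
proof -
  obtain V and \<rho> :: "'a \<Rightarrow> real" where "open V \<and> p \<in> V \<and> smooth_on V \<rho> \<and>
      (\<forall>q\<in>V. frechet_derivative \<rho> (at q) \<noteq> (\<lambda>_. 0)) \<and> \<Omega> \<inter> V = {q \<in> V. \<rho> q < 0}"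
    using bspec[OF assms(2)[unfolded smooth_boundary_def] assms(3)] by (elim exE)
  then have V: "open V" "p \<in> V" and sm: "smooth_on V \<rho>"
    and ne: "\<And>q. q \<in> V \<Longrightarrow> frechet_derivative \<rho> (at q) \<noteq> (\<lambda>_. 0)"
    and \<Omega>V: "\<Omega> \<inter> V = {q \<in> V. \<rho> q < 0}"
    by simp_all
  obtain n where n: "\<And>k. continuously_diff_on k V n" "\<And>y. y \<in> V \<Longrightarrow> (\<rho> has_derivative (\<lambda>v. n y \<bullet> v)) (at y)"
    using smooth_on_gradient[OF V(1) sm] by blast
  have n0: "n y \<noteq> 0" if "y \<in> V" for y
  proof
    assume "n y = 0"
    then have "frechet_derivative \<rho> (at y) = (\<lambda>_. 0)"
      using frechet_derivative_at[OF n(2)[OF that]] by simp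
    then show False using ne[OF that] by simp
  qed
  define G where "G = (\<lambda>(y, s). (y + s *\<^sub>R n y, \<rho> y))"
  let ?S = "V \<times> (UNIV :: real set)"
  have opS: "open ?S" using V(1) by (simp add: open_Times)
  have fst_sm: "continuously_diff_on k ?S (\<lambda>z. f (fst z))" if "continuously_diff_on k V f" for k and f :: "'a \<Rightarrow> 'c::real_normed_vector"
    by (rule continuously_diff_on_compose[OF opS _ continuously_diff_on_linear_map[OF bounded_linear_fst opS] that]) auto
  have smG: "smooth_on ?S G"
    unfolding smooth_on_def G_def case_prod_unfold
    by (intro allI continuously_diff_on_Pair continuously_diff_on_add continuously_diff_on_scaleR
        continuously_diff_on_linear_map[OF bounded_linear_fst] continuously_diff_on_linear_map[OF bounded_linear_snd]
        opS fst_sm n(1)) (use sm in \<open>simp add: smooth_on_def\<close>)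
  have derG: "(G has_derivative (\<lambda>(v, t). (v + t *\<^sub>R n p, n p \<bullet> v))) (at (p, 0))"
  proof -
    obtain n' where n': "(n has_derivative n') (at p)"
      using n(1)[of "Suc 0"] V(2) continuously_diff_on_SucD(1) by blast
    have fst_der: "(fst has_derivative fst) (at (p, 0::real))" and snd_der: "(snd has_derivative snd) (at (p, 0::real))"
      by (auto intro: bounded_linear_imp_has_derivative bounded_linear_fst bounded_linear_snd)
    have 1: "((\<lambda>z. n (fst z)) has_derivative (\<lambda>v. n' (fst v))) (at (p, 0::real))"
      using has_derivative_compose[OF fst_der, of n n'] n' by simp
    have 2: "((\<lambda>z. \<rho> (fst z)) has_derivative (\<lambda>v. n p \<bullet> fst v)) (at (p, 0::real))"
      using has_derivative_compose[OF fst_der, of \<rho> "\<lambda>v. n p \<bullet> v"] n(2)[OF V(2)] by simp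
    have "((\<lambda>z. (fst z + snd z *\<^sub>R n (fst z), \<rho> (fst z))) has_derivative
        (\<lambda>v. (fst v + (snd (p, 0::real) *\<^sub>R n' (fst v) + snd v *\<^sub>R n (fst (p, 0::real))), n p \<bullet> fst v))) (at (p, 0))"
      by (intro has_derivative_Pair has_derivative_add has_derivative_scaleR fst_der snd_der 1 2)
    then show ?thesis by (simp add: G_def case_prod_unfold)
  qed
  have inj: "w = 0" if "frechet_derivative G (at (p, 0)) w = 0" for w
  proof -
    obtain v t where w: "w = (v, t)" by (cases w)
    from that have 1: "v + t *\<^sub>R n p = 0" "n p \<bullet> v = 0"
      unfolding frechet_derivative_at[OF derG, symmetric] w by (auto simp: zero_prod_def)
    have "n p \<bullet> (v + t *\<^sub>R n p) = 0" using 1(1) by simp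
    then have "t * (n p \<bullet> n p) = 0" using 1(2) by (simp add: inner_add_right)
    then have "t = 0" using n0[OF V(2)] by simp
    then show ?thesis using 1 w by (simp add: zero_prod_def)
  qed
  have "(p, 0) \<in> ?S" using V(2) by simp
  then obtain U V' g where g: "open U" "U \<subseteq> ?S" "(p, 0) \<in> U" "open V'" "homeomorphism U V' G g" "smooth_on V' g"
    using smooth_inverse_function_theorem[OF opS smG _ inj] by metis
  obtain A B where AB: "open A" "open B" "p \<in> A" "(0::real) \<in> B" "A \<times> B \<subseteq> U"
    using open_prod_elim[OF g(1,3)] by (metis mem_Sigma_iff)
  obtain \<epsilon>1 where \<epsilon>1: "\<epsilon>1 > 0" "ball p \<epsilon>1 \<subseteq> A" using openE[OF AB(1,3)] by blast
  obtain \<epsilon>2 where \<epsilon>2: "\<epsilon>2 > 0" "ball 0 \<epsilon>2 \<subseteq> B" using openE[OF AB(2,4)] by blast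
  define m where "m = norm (n p) / 2"
  have m: "m > 0" using n0[OF V(2)] by (simp add: m_def)
  have "isCont n p"
    using n(1)[of 0] V by (simp add: continuous_on_eq_continuous_at)
  then have "((\<lambda>y. norm (n y)) \<longlongrightarrow> norm (n p)) (nhds p)"
    by (intro tendsto_norm) (simp add: isCont_def tendsto_at_iff_tendsto_nhds)
  then have "\<forall>\<^sub>F y in nhds p. m < norm (n y)"
    by (rule order_tendstoD) (use m in \<open>simp add: m_def\<close>)
  moreover have "\<forall>\<^sub>F y in nhds p. y \<in> V" using V by (rule eventually_nhds_in_open)
  ultimately have "\<forall>\<^sub>F y in nhds p. m < norm (n y) \<and> y \<in> V" by eventually_elim auto
  then obtain \<epsilon>3 where \<epsilon>3: "\<epsilon>3 > 0" "\<And>y. dist y p < \<epsilon>3 \<Longrightarrow> m < norm (n y) \<and> y \<in> V"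
    by (auto simp: eventually_nhds_metric)
  \<comment> \<open>The nearest boundary point of a point of \<open>ball p r\<close> lies in \<open>ball p (2 * r)\<close>, and its parameter is below \<open>r / m\<close>.\<close>
  define r where "r = min (min \<epsilon>1 \<epsilon>3) (\<epsilon>2 * m) / 2"
  have r: "r > 0" "2 * r \<le> \<epsilon>1" "2 * r \<le> \<epsilon>3" "r < \<epsilon>2 * m"
    using m \<epsilon>1(1) \<epsilon>2(1) \<epsilon>3(1) mult_pos_pos[OF \<epsilon>2(1) m] by (auto simp: r_def min_def)
  \<comment> \<open>The nearest boundary point and its parameter are the value of the local inverse at \<open>(x, 0)\<close>.\<close>
  have foot: "(x, 0) \<in> V' \<and> fst (g (x, 0)) \<in> V \<and>
      signed_dist \<Omega> x = snd (g (x, 0)) * norm (n (fst (g (x, 0))))" if x: "x \<in> ball p r" for x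
  proof -
    obtain y where y: "y \<in> frontier \<Omega>" "infdist x (frontier \<Omega>) = dist x y"
      using infdist_attains_inf[OF frontier_closed, of \<Omega> x] assms(3) by blast
    have dxy: "dist x y \<le> dist x p" using infdist_le[OF assms(3), of x] y(2) by simp
    have dxp: "dist x p < r" using x by (simp add: dist_commute)
    have "dist y p < 2 * r"
      using dist_triangle[of y p x] dxy dxp by (simp add: dist_commute)
    then have yV: "y \<in> V" and my: "m < norm (n y)" and yA: "y \<in> A"
      using \<epsilon>3(2)[of y] r \<epsilon>1(2) by (auto simp: dist_commute subset_iff)
    define s where "s = signed_dist \<Omega> x / norm (n y)"
    have "\<bar>signed_dist \<Omega> x\<bar> < \<epsilon>2 * m"
      using abs_signed_dist[of \<Omega> x] y(2) dxy dxp r(4) by simp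
    also have "\<epsilon>2 * m < \<epsilon>2 * norm (n y)" using \<epsilon>2(1) my by simp
    finally have "\<bar>s\<bar> < \<epsilon>2" using my m \<epsilon>2(1) by (simp add: s_def divide_less_eq)
    then have "s \<in> B" using \<epsilon>2(2) by (auto simp: dist_norm subset_iff)
    then have U: "(y, s) \<in> U" using yA AB(5) by blast
    have "x = y + s *\<^sub>R n y"
      unfolding s_def using nearest_point_normal[OF assms(1) V(1) \<Omega>V n(2)[OF yV] n0[OF yV] yV y(1)] y(2) by simp
    moreover have "\<rho> y = 0"
      using frontier_iff_defining_function_zero[OF assms(1) V(1) \<Omega>V n(2)[OF yV] n0[OF yV] yV] y(1) by simp
    ultimately have "G (y, s) = (x, 0)" by (simp add: G_def)
    moreover have "g (G (y, s)) = (y, s)" "G (y, s) \<in> V'"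
      using g(5) U unfolding homeomorphism_def by auto
    ultimately show ?thesis
      using yV n0[OF yV] by (simp add: s_def)
  qed
  have "continuously_diff_on k (ball p r) (signed_dist \<Omega>)" for k
  proof -
    let ?B = "ball p r"
    have lin: "continuously_diff_on k ?B (\<lambda>x. (x, 0::real))"
      by (intro continuously_diff_on_Pair continuously_diff_on_ident continuously_diff_on_const open_ball)
    have sg: "continuously_diff_on k ?B (\<lambda>x. g (x, 0))"
      by (rule continuously_diff_on_compose[OF open_ball _ lin, where T = V'])
         (use foot g(6) in \<open>auto simp: smooth_on_def\<close>)
    have sy: "continuously_diff_on k ?B (\<lambda>x. fst (g (x, 0)))"
      using continuously_diff_on_bounded_linear[OF bounded_linear_fst open_ball sg] .
    have ss: "continuously_diff_on k ?B (\<lambda>x. snd (g (x, 0)))"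
      using continuously_diff_on_bounded_linear[OF bounded_linear_snd open_ball sg] .
    have sn: "continuously_diff_on k ?B (\<lambda>x. n (fst (g (x, 0))))"
      by (rule continuously_diff_on_compose[OF open_ball _ sy n(1)]) (use foot in auto)
    have "continuously_diff_on k ?B (\<lambda>x. snd (g (x, 0)) * norm (n (fst (g (x, 0)))))"
      by (intro continuously_diff_on_mult ss continuously_diff_on_norm sn open_ball) (use foot n0 in auto)
    then show ?thesis
      using continuously_diff_on_cong[OF open_ball] foot by (metis (no_types, lifting))
  qed
  then show thesis using that[of "ball p r"] r(1) by (simp add: smooth_on_def)
qed

text \<open>
  The Lipschitz bound gives \<open>|n| \<le> 1\<close>; on the segment from \<open>x\<close> to its nearest boundary point the
  distance drops at least at unit speed, which gives \<open>|n| \<ge> 1\<close>.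
\<close>

lemma gradient_signed_dist_unit_off_frontier:
  fixes \<Omega> :: "'a::euclidean_space set"
  assumes "(signed_dist \<Omega> has_derivative (\<lambda>v. n \<bullet> v)) (at x)" "x \<notin> frontier \<Omega>" "frontier \<Omega> \<noteq> {}"
  shows "norm n = 1"
proof -
  obtain y where y: "y \<in> frontier \<Omega>" "infdist x (frontier \<Omega>) = dist x y"
    using infdist_attains_inf[OF frontier_closed assms(3), of x] by blast
  have xy: "x \<noteq> y" using y assms(2) by auto
  have upper: "n \<bullet> w \<le> norm w" for w
  proof (rule derivative_le_if_growth_le[OF assms(1), of 1])
    fix t :: real assume "0 < t"
    then show "signed_dist \<Omega> (x + t *\<^sub>R w) \<le> signed_dist \<Omega> x + t * norm w"
      using signed_dist_lipschitz[of \<Omega> "x + t *\<^sub>R w" x] by (simp add: dist_norm abs_le_iff)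
  qed simp
  have "norm n * norm n \<le> 1 * norm n"
    using upper[of n] by (simp add: dot_square_norm power2_eq_square)
  then have le: "norm n \<le> 1"
    by (cases "n = 0") simp_all
  have dist_seg: "infdist (x + t *\<^sub>R (y - x)) (frontier \<Omega>) \<le> dist x y - t * dist x y" if "0 < t" "t < 1" for t
  proof -
    have "x + t *\<^sub>R (y - x) - y = (1 - t) *\<^sub>R (x - y)" by (simp add: algebra_simps)
    then have "dist (x + t *\<^sub>R (y - x)) y = (1 - t) * dist x y"
      using that by (simp add: dist_norm)
    then show ?thesis using infdist_le[OF y(1), of "x + t *\<^sub>R (y - x)"] by (simp add: algebra_simps)
  qed
  have "dist x y \<le> \<bar>n \<bullet> (y - x)\<bar>"
  proof (cases "x \<in> \<Omega>")
    case True
    have "- (n \<bullet> (y - x)) \<le> - dist x y"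
    proof (rule derivative_le_if_growth_le[OF has_derivative_minus[OF assms(1)], of 1])
      fix t :: real assume "0 < t" "t < 1"
      then show "- signed_dist \<Omega> (x + t *\<^sub>R (y - x)) \<le> - signed_dist \<Omega> x + t * - dist x y"
        using dist_seg[of t] abs_signed_dist[of \<Omega> "x + t *\<^sub>R (y - x)"] True y(2)
        by (simp add: signed_dist_def[of \<Omega> x] abs_le_iff)
    qed simp
    then show ?thesis by linarith
  next
    case False
    have "n \<bullet> (y - x) \<le> - dist x y"
    proof (rule derivative_le_if_growth_le[OF assms(1), of 1])
      fix t :: real assume "0 < t" "t < 1"
      then show "signed_dist \<Omega> (x + t *\<^sub>R (y - x)) \<le> signed_dist \<Omega> x + t * - dist x y"
        using dist_seg[of t] abs_signed_dist[of \<Omega> "x + t *\<^sub>R (y - x)"] False y(2)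
        by (simp add: signed_dist_def[of \<Omega> x] abs_le_iff)
    qed simp
    then show ?thesis by linarith
  qed
  also have "\<dots> \<le> norm n * dist x y"
    using Cauchy_Schwarz_ineq2[of n "y - x"] by (simp add: dist_norm norm_minus_commute)
  finally have "1 \<le> norm n" using xy by simp
  with le show ?thesis by simp
qed

text \<open>
  On the boundary itself the gradient has length one by continuity, as a limit from inside \<open>\<Omega>\<close>.
\<close>

lemma signed_dist_eikonal:
  fixes \<Omega> :: "'a::euclidean_space set"
  assumes "open \<Omega>" "smooth_boundary \<Omega>" "p \<in> frontier \<Omega>"
  obtains W n where "open W" "p \<in> W" "smooth_on W (signed_dist \<Omega>)"
    "\<And>x. x \<in> W \<Longrightarrow> (signed_dist \<Omega> has_derivative (\<lambda>v. n x \<bullet> v)) (at x)"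
    "\<And>x. x \<in> W \<Longrightarrow> norm (n x) = 1"
proof -
  obtain W where W: "open W" "p \<in> W" "smooth_on W (signed_dist \<Omega>)"
    using signed_dist_smooth[OF assms] by blast
  obtain n where n: "\<And>k. continuously_diff_on k W n"
      "\<And>y. y \<in> W \<Longrightarrow> (signed_dist \<Omega> has_derivative (\<lambda>v. n y \<bullet> v)) (at y)"
    using smooth_on_gradient[OF W(1,3)] by blast
  have off: "norm (n x) = 1" if "x \<in> W" "x \<notin> frontier \<Omega>" for x
    using gradient_signed_dist_unit_off_frontier[OF n(2)[OF that(1)] that(2)] assms(3) by blast
  have unit: "norm (n x) = 1" if x: "x \<in> W" for x
  proof (cases "x \<in> frontier \<Omega>")
    case True
    then have "x islimpt \<Omega>"
      using assms(1) by (auto simp: frontier_def interior_open closure_def)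
    then have nt: "at x within \<Omega> \<noteq> bot" by (simp add: trivial_limit_within)
    have "isCont n x" using n(1)[of 0] W(1) x by (simp add: continuous_on_eq_continuous_at)
    then have "((\<lambda>y. norm (n y)) \<longlongrightarrow> norm (n x)) (at x within \<Omega>)"
      by (intro tendsto_norm) (auto simp: isCont_def intro: tendsto_within_subset)
    moreover have "\<forall>\<^sub>F y in at x within \<Omega>. norm (n y) = 1"
    proof -
      have "\<forall>\<^sub>F y in at x within \<Omega>. y \<in> W \<and> y \<in> \<Omega>"
        using W(1) x by (auto simp: eventually_at_topological)
      then show ?thesis
        by eventually_elim (use off assms(1) in \<open>auto simp: frontier_def interior_open\<close>)
    qed
    then have "((\<lambda>y. norm (n y)) \<longlongrightarrow> 1) (at x within \<Omega>)"
      by (rule tendsto_eventually)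
    ultimately show ?thesis by (rule tendsto_unique[OF nt])
  qed (use off x in auto)
  show thesis by (rule that[OF W n(2) unit])
qed

section \<open>Symmetry of second derivatives\<close>

lemma frechet_derivative_bounded_linear_comp:
  assumes "bounded_linear h" "f differentiable (at x)"
  shows "frechet_derivative (\<lambda>x. h (f x)) (at x) = (\<lambda>v. h (frechet_derivative f (at x) v))"
  by (rule frechet_derivative_at[symmetric], rule bounded_linear.has_derivative[OF assms(1)])
     (use assms(2) frechet_derivative_works in blast)

text \<open>
  The mean value theorem, applied once in each of the two directions.
\<close>

lemma mixed_difference_mean_value:
  fixes f :: "'a::euclidean_space \<Rightarrow> real"
  assumes S: "\<And>s t. 0 \<le> s \<Longrightarrow> s \<le> h \<Longrightarrow> 0 \<le> t \<Longrightarrow> t \<le> h \<Longrightarrow> p + s *\<^sub>R u + t *\<^sub>R v \<in> S"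
    and f: "continuously_diff_on (Suc (Suc k)) S f" and "h > 0"
  obtains s t where "0 < s" "s < h" "0 < t" "t < h"
    "f (p + h *\<^sub>R u + h *\<^sub>R v) - f (p + h *\<^sub>R u) - f (p + h *\<^sub>R v) + f p
      = h * h * frechet_derivative (\<lambda>x. frechet_derivative f (at x) u) (at (p + s *\<^sub>R u + t *\<^sub>R v)) v"
proof -
  let ?D = "\<lambda>x. frechet_derivative f (at x)"
  have line: "((\<lambda>s. F (q + s *\<^sub>R w)) has_real_derivative frechet_derivative F (at (q + s *\<^sub>R w)) w) (at s)"
    if "continuously_diff_on (Suc j) S F" "q + s *\<^sub>R w \<in> S" for j F q w s
  proof -
    have "((\<lambda>t. F ((q + s *\<^sub>R w) + t *\<^sub>R w)) has_real_derivative frechet_derivative F (at (q + s *\<^sub>R w)) w) (at 0)"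
      by (rule has_derivative_along_line[OF continuously_diff_on_SucD(1)[OF that]])
    then have "((\<lambda>t. F (q + (s + t) *\<^sub>R w)) has_real_derivative frechet_derivative F (at (q + s *\<^sub>R w)) w) (at 0)"
      by (simp add: scaleR_add_left add.assoc)
    then show ?thesis
      using DERIV_shift[of "\<lambda>t. F (q + t *\<^sub>R w)" _ 0 s] by (simp add: add.commute)
  qed
  let ?\<phi> = "\<lambda>s. f (p + h *\<^sub>R v + s *\<^sub>R u) - f (p + s *\<^sub>R u)"
  have "(?\<phi> has_real_derivative (?D (p + h *\<^sub>R v + s *\<^sub>R u) u - ?D (p + s *\<^sub>R u) u)) (at s)" if "0 \<le> s" "s \<le> h" for s
    using S[OF that, of h] S[OF that, of 0] \<open>h > 0\<close>
    by (intro DERIV_diff line[OF f]) (simp_all add: add.commute add.left_commute)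
  then obtain s where s: "0 < s" "s < h" "?\<phi> h - ?\<phi> 0 = (h - 0) * (?D (p + h *\<^sub>R v + s *\<^sub>R u) u - ?D (p + s *\<^sub>R u) u)"
    using MVT2[of 0 h ?\<phi> "\<lambda>s. ?D (p + h *\<^sub>R v + s *\<^sub>R u) u - ?D (p + s *\<^sub>R u) u"] \<open>h > 0\<close> by auto
  have "((\<lambda>t. ?D (p + s *\<^sub>R u + t *\<^sub>R v) u) has_real_derivative
      frechet_derivative (\<lambda>x. ?D x u) (at (p + s *\<^sub>R u + t *\<^sub>R v)) v) (at t)" if "0 \<le> t" "t \<le> h" for t
    using S[of s t] that s(1,2) by (intro line[OF continuously_diff_on_SucD(2)[OF f]]) simp
  then obtain t where t: "0 < t" "t < h" "?D (p + s *\<^sub>R u + h *\<^sub>R v) u - ?D (p + s *\<^sub>R u + 0 *\<^sub>R v) u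
      = (h - 0) * frechet_derivative (\<lambda>x. ?D x u) (at (p + s *\<^sub>R u + t *\<^sub>R v)) v"
    using MVT2[of 0 h "\<lambda>t. ?D (p + s *\<^sub>R u + t *\<^sub>R v) u"
        "\<lambda>t. frechet_derivative (\<lambda>x. ?D x u) (at (p + s *\<^sub>R u + t *\<^sub>R v)) v"] \<open>h > 0\<close> by auto
  have "?D (p + h *\<^sub>R v + s *\<^sub>R u) u - ?D (p + s *\<^sub>R u) u
      = h * frechet_derivative (\<lambda>x. ?D x u) (at (p + s *\<^sub>R u + t *\<^sub>R v)) v"
    using t(3) by (simp add: add_ac)
  then have "f (p + h *\<^sub>R u + h *\<^sub>R v) - f (p + h *\<^sub>R u) - f (p + h *\<^sub>R v) + f p
      = h * h * frechet_derivative (\<lambda>x. ?D x u) (at (p + s *\<^sub>R u + t *\<^sub>R v)) v"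
    using s(3) by (simp add: add_ac)
  then show thesis using that s(1,2) t(1,2) by blast
qed

text \<open>
  The second difference over a small parallelogram does not depend on the order of the directions, and
  it is the square of the step times either mixed derivative at nearby points.
\<close>

lemma second_derivative_symmetric_real:
  fixes f :: "'a::euclidean_space \<Rightarrow> real"
  assumes "open S" "p \<in> S" and f: "continuously_diff_on (Suc (Suc k)) S f"
  shows "frechet_derivative (\<lambda>x. frechet_derivative f (at x) u) (at p) v
       = frechet_derivative (\<lambda>x. frechet_derivative f (at x) v) (at p) u"
proof -
  define D where "D u v x = frechet_derivative (\<lambda>x. frechet_derivative f (at x) u) (at x) v" for u v x
  have cont: "isCont (D u v) p" for u v
    using continuously_diff_on_imp_continuous_on[OF continuously_diff_on_SucD(2)[OF continuously_diff_on_SucD(2)[OF f]], of u v]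
      assms(1,2) unfolding D_def by (simp add: continuous_on_eq_continuous_at)
  have "\<bar>D u v p - D v u p\<bar> \<le> \<epsilon>" if "\<epsilon> > 0" for \<epsilon>
  proof -
    have ev: "\<forall>\<^sub>F x in nhds p. dist (D u v x) (D u v p) < \<epsilon> / 2" for u v
    proof (rule tendstoD)
      show "(D u v \<longlongrightarrow> D u v p) (nhds p)"
        using cont[of u v] unfolding isCont_def tendsto_at_iff_tendsto_nhds .
    qed (use that in simp)
    have "\<forall>\<^sub>F x in nhds p. x \<in> S" using assms(1,2) by (rule eventually_nhds_in_open)
    with ev[of u v] ev[of v u]
    have "\<forall>\<^sub>F x in nhds p. x \<in> S \<and> dist (D u v x) (D u v p) < \<epsilon> / 2 \<and> dist (D v u x) (D v u p) < \<epsilon> / 2"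
      by eventually_elim simp
    then obtain r where r: "r > 0" "\<And>x. dist x p < r \<Longrightarrow> x \<in> S \<and> dist (D u v x) (D u v p) < \<epsilon> / 2 \<and> dist (D v u x) (D v u p) < \<epsilon> / 2"
      unfolding eventually_nhds_metric by blast
    define h where "h = r / (norm u + norm v + 1)"
    have nn: "norm u + norm v + 1 > 0" by (simp add: add_nonneg_pos)
    have h: "h > 0" "h * (norm u + norm v) < r"
      using r(1) nn by (simp_all add: h_def divide_less_eq)
    have near: "dist (p + s *\<^sub>R u + t *\<^sub>R v) p < r" if "0 \<le> s" "s \<le> h" "0 \<le> t" "t \<le> h" for s t
    proof -
      have "dist (p + s *\<^sub>R u + t *\<^sub>R v) p = norm (s *\<^sub>R u + t *\<^sub>R v)" by (simp add: dist_norm add.assoc)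
      also have "\<dots> \<le> s * norm u + t * norm v"
        using norm_triangle_ineq[of "s *\<^sub>R u" "t *\<^sub>R v"] that by simp
      also have "\<dots> \<le> h * norm u + h * norm v" using that by (intro add_mono mult_right_mono) auto
      also have "\<dots> < r" using h(2) by (simp add: distrib_left)
      finally show ?thesis .
    qed
    have near': "dist (p + s *\<^sub>R v + t *\<^sub>R u) p < r" if "0 \<le> s" "s \<le> h" "0 \<le> t" "t \<le> h" for s t
      using near[OF that(3,4,1,2)] by (simp add: add_ac)
    obtain s t where 1: "0 < s" "s < h" "0 < t" "t < h"
      "f (p + h *\<^sub>R u + h *\<^sub>R v) - f (p + h *\<^sub>R u) - f (p + h *\<^sub>R v) + f p = h * h * D u v (p + s *\<^sub>R u + t *\<^sub>R v)"
      unfolding D_def by (rule mixed_difference_mean_value[OF _ f h(1), of p u v]) (use near r(2) in auto)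
    obtain s' t' where 2: "0 < s'" "s' < h" "0 < t'" "t' < h"
      "f (p + h *\<^sub>R v + h *\<^sub>R u) - f (p + h *\<^sub>R v) - f (p + h *\<^sub>R u) + f p = h * h * D v u (p + s' *\<^sub>R v + t' *\<^sub>R u)"
      unfolding D_def by (rule mixed_difference_mean_value[OF _ f h(1), of p v u]) (use near' r(2) in auto)
    have "h * h * D u v (p + s *\<^sub>R u + t *\<^sub>R v) = h * h * D v u (p + s' *\<^sub>R v + t' *\<^sub>R u)"
      using 1(5) 2(5) unfolding add.assoc add.commute[of "h *\<^sub>R v"] by linarith
    then have "D u v (p + s *\<^sub>R u + t *\<^sub>R v) = D v u (p + s' *\<^sub>R v + t' *\<^sub>R u)"
      using h(1) by simp
    moreover have "dist (D u v (p + s *\<^sub>R u + t *\<^sub>R v)) (D u v p) < \<epsilon> / 2"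
      using r(2)[OF near] 1(1-4) by simp
    moreover have "dist (D v u (p + s' *\<^sub>R v + t' *\<^sub>R u)) (D v u p) < \<epsilon> / 2"
      using r(2)[OF near'] 2(1-4) by simp
    ultimately show ?thesis unfolding dist_real_def by linarith
  qed
  then have "\<bar>D u v p - D v u p\<bar> \<le> 0" by (rule field_le_epsilon) simp
  then show ?thesis unfolding D_def by simp
qed

lemma second_derivative_symmetric:
  fixes f :: "'a::euclidean_space \<Rightarrow> 'b::euclidean_space"
  assumes "open S" "p \<in> S" and f: "continuously_diff_on (Suc (Suc k)) S f"
  shows "frechet_derivative (\<lambda>x. frechet_derivative f (at x) u) (at p) v
       = frechet_derivative (\<lambda>x. frechet_derivative f (at x) v) (at p) u"
proof (rule euclidean_eqI)
  fix b :: 'b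
  have D2: "frechet_derivative (\<lambda>x. frechet_derivative (\<lambda>x. f x \<bullet> b) (at x) u) (at p) v
      = frechet_derivative (\<lambda>x. frechet_derivative f (at x) u) (at p) v \<bullet> b" for u v
  proof -
    have eq: "frechet_derivative (\<lambda>x. f x \<bullet> b) (at x) u = frechet_derivative f (at x) u \<bullet> b" if "x \<in> S" for x
      using frechet_derivative_bounded_linear_comp[OF bounded_linear_inner_left, of f x b] f that by simp
    have der: "((\<lambda>x. frechet_derivative f (at x) u) has_derivative
        frechet_derivative (\<lambda>x. frechet_derivative f (at x) u) (at p)) (at p)"
      using continuously_diff_on_SucD(1)[OF continuously_diff_on_SucD(2)[OF f] assms(2)] .
    have "((\<lambda>x. frechet_derivative (\<lambda>x. f x \<bullet> b) (at x) u) has_derivative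
        (\<lambda>v. frechet_derivative (\<lambda>x. frechet_derivative f (at x) u) (at p) v \<bullet> b)) (at p)"
      by (rule has_derivative_transform_within_open[OF bounded_linear.has_derivative[OF bounded_linear_inner_left der] assms(1,2)])
         (simp add: eq)
    then show ?thesis using frechet_derivative_at by metis
  qed
  have "continuously_diff_on (Suc (Suc k)) S (\<lambda>x. f x \<bullet> b)"
    by (rule continuously_diff_on_bounded_linear[OF bounded_linear_inner_left assms(1) f])
  from second_derivative_symmetric_real[OF assms(1,2) this, of u v]
  show "frechet_derivative (\<lambda>x. frechet_derivative f (at x) u) (at p) v \<bullet> b
      = frechet_derivative (\<lambda>x. frechet_derivative f (at x) v) (at p) u \<bullet> b"
    unfolding D2 .
qed

section \<open>Wirtinger derivatives\<close>

text \<open>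
  With \<open>c = - \<i>\<close> this is \<open>\<partial>/\<partial>z\<^sup>i\<close> and with \<open>c = \<i>\<close> its conjugate, so each rule of calculus is proved for
  both at once.
\<close>

definition wirtinger :: "complex \<Rightarrow> 'n::finite \<Rightarrow> (complex^'n \<Rightarrow> complex) \<Rightarrow> complex^'n \<Rightarrow> complex" where
  "wirtinger c i f p = (frechet_derivative f (at p) (axis i 1) + c * frechet_derivative f (at p) (axis i \<i>)) / 2"

lemma dz_eq_wirtinger: "dz = wirtinger (- \<i>)"
  by (intro ext) (simp add: dz_def wirtinger_def)

lemma dzbar_eq_wirtinger: "dzbar = wirtinger \<i>"
  by (intro ext) (simp add: dzbar_def wirtinger_def)

lemma wirtinger_const: "wirtinger c i (\<lambda>x. k) p = 0"
  by (simp add: wirtinger_def)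

lemma wirtinger_mult:
  assumes "f differentiable (at p)" "g differentiable (at p)"
  shows "wirtinger c i (\<lambda>x. f x * g x) p = wirtinger c i f p * g p + f p * wirtinger c i g p"
proof -
  have "frechet_derivative (\<lambda>x. f x * g x) (at p)
      = (\<lambda>v. f p * frechet_derivative g (at p) v + frechet_derivative f (at p) v * g p)"
    using has_derivative_mult[OF assms[unfolded frechet_derivative_works]] by (rule frechet_derivative_at[symmetric])
  then show ?thesis by (simp add: wirtinger_def field_simps)
qed

lemma wirtinger_cmult:
  assumes "f differentiable (at p)"
  shows "wirtinger c i (\<lambda>x. k * f x) p = k * wirtinger c i f p"
  using wirtinger_mult[OF _ assms, of "\<lambda>_. k"] by (simp add: wirtinger_const)

lemma wirtinger_sum:
  assumes "\<And>j. j \<in> J \<Longrightarrow> f j differentiable (at p)"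
  shows "wirtinger c i (\<lambda>x. \<Sum>j\<in>J. f j x) p = (\<Sum>j\<in>J. wirtinger c i (f j) p)"
proof -
  have "frechet_derivative (\<lambda>x. \<Sum>j\<in>J. f j x) (at p) = (\<lambda>v. \<Sum>j\<in>J. frechet_derivative (f j) (at p) v)"
    using has_derivative_sum[of J f "\<lambda>j. frechet_derivative (f j) (at p)"] assms
    by (intro frechet_derivative_at[symmetric]) (auto simp: frechet_derivative_works)
  then show ?thesis
    by (simp add: wirtinger_def sum.distrib sum_distrib_left sum_divide_distrib add_divide_distrib)
qed

lemma wirtinger_add:
  assumes "f differentiable (at p)" "g differentiable (at p)"
  shows "wirtinger c i (\<lambda>x. f x + g x) p = wirtinger c i f p + wirtinger c i g p"
proof -
  have "frechet_derivative (\<lambda>x. f x + g x) (at p)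
      = (\<lambda>v. frechet_derivative f (at p) v + frechet_derivative g (at p) v)"
    using has_derivative_add[OF assms[unfolded frechet_derivative_works]] by (rule frechet_derivative_at[symmetric])
  then show ?thesis by (simp add: wirtinger_def field_simps)
qed

lemma wirtinger_sum_mult:
  assumes "\<And>j. f j differentiable (at p)" "\<And>j. g j differentiable (at p)"
  shows "wirtinger c i (\<lambda>x. \<Sum>j\<in>J. f j x * g j x) p
    = (\<Sum>j\<in>J. wirtinger c i (f j) p * g j p + f j p * wirtinger c i (g j) p)"
  using assms by (simp add: wirtinger_sum wirtinger_mult)

lemma wirtinger_cnj:
  assumes "f differentiable (at p)"
  shows "wirtinger c i (\<lambda>x. cnj (f x)) p = cnj (wirtinger (cnj c) i f p)"
  using frechet_derivative_bounded_linear_comp[OF bounded_linear_cnj assms] by (simp add: wirtinger_def)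

lemma wirtinger_cong:
  assumes "open S" "p \<in> S" "\<And>x. x \<in> S \<Longrightarrow> f x = g x"
  shows "wirtinger c i f p = wirtinger c i g p"
proof -
  have "(f has_derivative f') (at p) \<longleftrightarrow> (g has_derivative f') (at p)" for f'
    using has_derivative_transform_within_open[OF _ assms(1,2)] assms(3) by metis
  then show ?thesis unfolding wirtinger_def frechet_derivative_def by simp
qed

lemma continuously_diff_on_wirtinger:
  assumes "open S" "continuously_diff_on (Suc k) S f"
  shows "continuously_diff_on k S (wirtinger c i f)"
  unfolding wirtinger_def divide_inverse
  by (intro continuously_diff_on_mult continuously_diff_on_add continuously_diff_on_const assms(1)
      continuously_diff_on_SucD(2)[OF assms(2)])

lemma wirtinger_commute:
  assumes "open S" "p \<in> S" "continuously_diff_on (Suc (Suc k)) S f"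
  shows "wirtinger c i (wirtinger d j f) p = wirtinger d j (wirtinger c i f) p"
proof -
  let ?D = "\<lambda>u. \<lambda>x. frechet_derivative f (at x) u"
  have D2: "frechet_derivative (wirtinger d j f) (at p) v =
      (frechet_derivative (?D (axis j 1)) (at p) v + d * frechet_derivative (?D (axis j \<i>)) (at p) v) / 2" for d j v
  proof -
    have der: "(?D u has_derivative frechet_derivative (?D u) (at p)) (at p)" for u
      using continuously_diff_on_SucD(1)[OF continuously_diff_on_SucD(2)[OF assms(3)] assms(2)] .
    have "(wirtinger d j f has_derivative (\<lambda>v. (frechet_derivative (?D (axis j 1)) (at p) v
        + d * frechet_derivative (?D (axis j \<i>)) (at p) v) / 2)) (at p)"
      unfolding wirtinger_def divide_inverse
      by (intro has_derivative_mult_left has_derivative_add has_derivative_mult_right der)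
    then show ?thesis by (rule fun_cong[OF frechet_derivative_at[symmetric]])
  qed
  note sym = second_derivative_symmetric[OF assms]
  show ?thesis
    unfolding wirtinger_def[of c i "wirtinger d j f"] wirtinger_def[of d j "wirtinger c i f"] D2
      sym[of "axis i 1" "axis j 1"] sym[of "axis i 1" "axis j \<i>"]
      sym[of "axis i \<i>" "axis j 1"] sym[of "axis i \<i>" "axis j \<i>"]
    by (simp add: algebra_simps add_divide_distrib)
qed

lemmas dz_add = wirtinger_add[where c = "- \<i>", folded dz_eq_wirtinger]
lemmas dz_mult = wirtinger_mult[where c = "- \<i>", folded dz_eq_wirtinger]
lemmas dz_cmult = wirtinger_cmult[where c = "- \<i>", folded dz_eq_wirtinger]
lemmas dz_sum = wirtinger_sum[where c = "- \<i>", folded dz_eq_wirtinger]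
lemmas dz_sum_mult = wirtinger_sum_mult[where c = "- \<i>", folded dz_eq_wirtinger]
lemmas dz_const = wirtinger_const[where c = "- \<i>", folded dz_eq_wirtinger]
lemmas dz_cong = wirtinger_cong[where c = "- \<i>", folded dz_eq_wirtinger]
lemmas dzbar_sum_mult = wirtinger_sum_mult[where c = "\<i>", folded dzbar_eq_wirtinger]
lemmas dzbar_const = wirtinger_const[where c = "\<i>", folded dzbar_eq_wirtinger]
lemmas dzbar_cong = wirtinger_cong[where c = "\<i>", folded dzbar_eq_wirtinger]

lemma cnj_dz: "f differentiable (at x) \<Longrightarrow> cnj (dz i f x) = dzbar i (\<lambda>x. cnj (f x)) x"
  by (simp add: dz_eq_wirtinger dzbar_eq_wirtinger wirtinger_cnj)

text \<open>
  Allows real information about derivatives to be used: for real \<open>f\<close> the imaginary part of \<open>Xf\<close> is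
  half the negated derivative along \<open>\<i> X\<close>.
\<close>

lemma vec_deriv_eq_frechet:
  assumes "f differentiable (at p)"
  shows "vec_deriv X f p = (frechet_derivative f (at p) X - \<i> * frechet_derivative f (at p) (\<i> *s X)) / 2"
proof -
  let ?D = "frechet_derivative f (at p)"
  have lin: "linear ?D" using assms by (rule linear_frechet_derivative)
  have ax: "axis i z = Re z *\<^sub>R axis i 1 + Im z *\<^sub>R axis i \<i>" for i :: 'a and z
    by (simp add: vec_eq_iff axis_def complex_eq_iff)
  have D_ax: "?D (axis i z) = Re z *\<^sub>R ?D (axis i 1) + Im z *\<^sub>R ?D (axis i \<i>)" for i z
    by (subst ax) (simp add: linear_add[OF lin] linear_scale[OF lin])
  have expand: "?D Y = (\<Sum>i\<in>UNIV. ?D (axis i (Y $ i)))" for Y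
  proof -
    have "Y = (\<Sum>i\<in>UNIV. axis i (Y $ i))"
      by (simp add: vec_eq_iff axis_def if_distrib cong: if_cong)
    then show ?thesis using linear_sum[OF lin] by metis
  qed
  have "X $ i * dz i f p = (?D (axis i (X $ i)) - \<i> * ?D (axis i ((\<i> *s X) $ i))) / 2" for i
    unfolding dz_def D_ax[of i "X $ i"] D_ax[of i "(\<i> *s X) $ i"]
    by (simp add: complex_eq_iff algebra_simps)
  then show ?thesis
    unfolding vec_deriv_def expand[of X] expand[of "\<i> *s X"]
    by (simp add: sum_subtractf sum_distrib_left sum_divide_distrib diff_divide_distrib)
qed

lemma smooth_on_dz: "open W \<Longrightarrow> smooth_on W f \<Longrightarrow> smooth_on W (dz i f)"
  unfolding dz_eq_wirtinger smooth_on_def using continuously_diff_on_wirtinger by metis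

lemma smooth_on_dzbar: "open W \<Longrightarrow> smooth_on W f \<Longrightarrow> smooth_on W (dzbar i f)"
  unfolding dzbar_eq_wirtinger smooth_on_def using continuously_diff_on_wirtinger by metis

lemma smooth_on_differentiable: "smooth_on W f \<Longrightarrow> x \<in> W \<Longrightarrow> f differentiable (at x)"
  unfolding smooth_on_def using continuously_diff_on.simps(2) by blast

lemma dz_commute:
  assumes "open W" "smooth_on W f" "x \<in> W"
  shows "dz i (dzbar j f) x = dzbar j (dz i f) x" "dz i (dz j f) x = dz j (dz i f) x"
    "dzbar i (dzbar j f) x = dzbar j (dzbar i f) x"
  unfolding dz_eq_wirtinger dzbar_eq_wirtinger
  using wirtinger_commute[OF assms(1,3)] assms(2) unfolding smooth_on_def by blast+

section \<open>Boundary minima and null vectors\<close>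

text \<open>
  For a tangent vector \<open>v\<close> the point \<open>p + t v\<close> has distance \<open>o(t)\<close> from the boundary, because \<open>\<delta>\<close>
  has derivative zero along \<open>v\<close>. So a nearest boundary point serves as a point of a curve with velocity
  \<open>v\<close>, and \<open>0 \<le> g\<close> there gives \<open>0 \<le> t g'(v) + o(t)\<close>. The same holds for \<open>- v\<close>.
\<close>

lemma tangential_derivative_zero_at_min:
  fixes \<Omega> :: "'a::euclidean_space set" and g :: "'a \<Rightarrow> real"
  assumes p: "p \<in> frontier \<Omega>" and \<delta>: "(signed_dist \<Omega> has_derivative (\<lambda>v. n \<bullet> v)) (at p)"
    and g: "(g has_derivative g') (at p)" "g p = 0"
    and W: "open W" "p \<in> W" "\<And>q. q \<in> frontier \<Omega> \<inter> W \<Longrightarrow> g q \<ge> 0"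
    and tangent: "n \<bullet> v = 0"
  shows "g' v = 0"
proof -
  have \<delta>p: "signed_dist \<Omega> p = 0" using abs_signed_dist[of \<Omega> p] p by simp
  obtain K where K: "\<And>w. norm (g' w) \<le> norm w * K" "K > 0"
    using has_derivative_bounded_linear[OF g(1)] bounded_linear.pos_bounded by blast
  have lin: "linear g'" using g(1) by (rule has_derivative_linear)
  have nonneg: "g' v \<ge> 0" if tangent: "n \<bullet> v = 0" for v
  proof (cases "v = 0")
    case True
    then show ?thesis using linear_0[OF lin] by simp
  next
    case False
    have *: "- g' v \<le> \<epsilon> * ((K + 2) * norm v)" if \<epsilon>: "0 < \<epsilon>" "\<epsilon> < 1" for \<epsilon>
    proof -
      obtain r1 where r1: "r1 > 0" "\<And>y. norm (y - p) < r1 \<Longrightarrow> norm (g y - g p - g' (y - p)) \<le> \<epsilon> * norm (y - p)"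
        using g(1) \<epsilon>(1) unfolding has_derivative_at_alt by blast
      obtain r2 where r2: "r2 > 0" "\<And>y. norm (y - p) < r2 \<Longrightarrow>
          norm (signed_dist \<Omega> y - signed_dist \<Omega> p - n \<bullet> (y - p)) \<le> \<epsilon> * norm (y - p)"
        using \<delta> \<epsilon>(1) unfolding has_derivative_at_alt by blast
      obtain r3 where r3: "r3 > 0" "ball p r3 \<subseteq> W" using openE[OF W(1,2)] by blast
      define r where "r = min r1 (min r2 r3)"
      have r: "r > 0" "r \<le> r1" "r \<le> r2" "r \<le> r3" using r1(1) r2(1) r3(1) by (auto simp: r_def)
      define t where "t = r / (4 * norm v)"
      have t: "t > 0" "2 * (t * norm v) < r" using r(1) False by (auto simp: t_def)
      define x where "x = p + t *\<^sub>R v"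
      have xp: "x - p = t *\<^sub>R v" "norm (x - p) = t * norm v" using t(1) by (simp_all add: x_def)
      obtain q where q: "q \<in> frontier \<Omega>" "infdist x (frontier \<Omega>) = dist x q"
        using infdist_attains_inf[OF frontier_closed, of \<Omega> x] p by blast
      have tv: "t * norm v \<ge> 0" using t(1) by simp
      have "t * norm v < r2" using t(2) r(3) tv by linarith
      then have "\<bar>signed_dist \<Omega> x\<bar> \<le> \<epsilon> * (t * norm v)"
        using r2(2)[of x, unfolded xp(2), unfolded xp(1)] \<delta>p tangent by simp
      then have xq: "norm (q - x) \<le> \<epsilon> * (t * norm v)"
        using abs_signed_dist[of \<Omega> x] q(2) by (simp add: dist_norm norm_minus_commute)
      also have "\<dots> \<le> 1 * (t * norm v)" using \<epsilon> tv by (intro mult_right_mono) auto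
      finally have qp: "norm (q - p) \<le> 2 * (t * norm v)"
        using norm_triangle_ineq[of "q - x" "x - p"] xp(2) by simp
      then have "norm (q - p) < r" using t(2) by simp
      then have "q \<in> W" using r(4) r3(2) by (auto simp: subset_iff dist_norm norm_minus_commute)
      then have "0 \<le> g q" using W(3) q(1) by blast
      also have "g q \<le> g' (q - p) + \<epsilon> * norm (q - p)"
        using r1(2)[of q] \<open>norm (q - p) < r\<close> r(2) g(2) by simp
      also have "\<dots> \<le> g' (q - p) + \<epsilon> * (2 * (t * norm v))"
        using qp \<epsilon> by (intro add_left_mono mult_left_mono) auto
      also have "g' (q - p) = t * g' v + g' (q - x)"
        using linear_add[OF lin, of "x - p" "q - x"] linear_scale[OF lin, of t v] unfolding xp(1)[symmetric] by simp
      also have "g' (q - x) \<le> norm (q - x) * K" using K(1)[of "q - x"] by simp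
      also have "\<dots> \<le> \<epsilon> * (t * norm v) * K" using xq K(2) by (intro mult_right_mono) auto
      finally have "t * (- g' v) \<le> t * (\<epsilon> * ((K + 2) * norm v))"
        by (simp add: algebra_simps)
      then show ?thesis using t(1) by (simp only: mult_le_cancel_left_pos)
    qed
    have "- g' v \<le> 0 + e" if "e > 0" for e
    proof -
      define M where "M = (K + 2) * norm v"
      have M: "M \<ge> 0" using K(2) by (simp add: M_def)
      define \<epsilon> where "\<epsilon> = min (1 / 2) (e / (M + 1))"
      have "0 < \<epsilon>" "\<epsilon> < 1" using that M by (auto simp: \<epsilon>_def)
      then have "- g' v \<le> \<epsilon> * M" using * M_def by blast
      also have "\<dots> \<le> e / (M + 1) * M" using M by (intro mult_right_mono) (auto simp: \<epsilon>_def)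
      also have "\<dots> \<le> e" using M that by (simp add: divide_le_eq)
      finally show ?thesis by simp
    qed
    then have "- g' v \<le> 0" by (rule field_le_epsilon)
    then show ?thesis by simp
  qed
  have "g' (- v) \<ge> 0" using tangent by (intro nonneg) simp
  then show ?thesis using nonneg[OF tangent] linear_neg[OF lin, of v] by simp
qed

text \<open>
  \<open>Q(L - t w X) = - 2 t |w|\<^sup>2 + t\<^sup>2 |w|\<^sup>2 Q(X)\<close>, where \<open>w\<close> is the sum to be shown zero; for small \<open>t > 0\<close> this
  is negative unless \<open>w = 0\<close>.
\<close>

lemma semidefinite_null_vector:
  fixes h :: "'n::finite \<Rightarrow> 'n \<Rightarrow> complex" and a :: "'n \<Rightarrow> complex"
  defines "Q \<equiv> \<lambda>X. \<Sum>i\<in>UNIV. \<Sum>j\<in>UNIV. h i j * X i * cnj (X j)"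
  assumes herm: "\<And>i j. cnj (h i j) = h j i"
    and psd: "\<And>X. (\<Sum>i\<in>UNIV. X i * a i) = 0 \<Longrightarrow> Q X \<ge> 0"
    and L: "(\<Sum>i\<in>UNIV. L i * a i) = 0" "Q L = 0"
    and X: "(\<Sum>i\<in>UNIV. X i * a i) = 0"
  shows "(\<Sum>j\<in>UNIV. (\<Sum>i\<in>UNIV. L i * h i j) * cnj (X j)) = 0"
proof -
  define w where "w = (\<Sum>j\<in>UNIV. (\<Sum>i\<in>UNIV. L i * h i j) * cnj (X j))"
  have w1: "(\<Sum>i\<in>UNIV. \<Sum>j\<in>UNIV. h i j * L i * cnj (X j)) = w"
    unfolding w_def sum_distrib_right by (subst sum.swap) (simp add: mult_ac)
  have w2: "(\<Sum>i\<in>UNIV. \<Sum>j\<in>UNIV. h i j * X i * cnj (L j)) = cnj w"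
    unfolding w_def by (simp add: sum_distrib_right sum_distrib_left herm mult_ac)
  have Q_exp: "Q (\<lambda>i. L i - z * X i) = Q L - cnj z * w - z * cnj w + z * cnj z * Q X" for z
  proof -
    have "Q (\<lambda>i. L i - z * X i) = Q L - cnj z * (\<Sum>i\<in>UNIV. \<Sum>j\<in>UNIV. h i j * L i * cnj (X j))
        - z * (\<Sum>i\<in>UNIV. \<Sum>j\<in>UNIV. h i j * X i * cnj (L j)) + z * cnj z * Q X"
      unfolding Q_def sum_distrib_left sum.distrib[symmetric] sum_subtractf[symmetric]
      by (intro sum.cong refl) (simp add: algebra_simps)
    then show ?thesis unfolding w1 w2 .
  qed
  have tan: "(\<Sum>i\<in>UNIV. (L i - z * X i) * a i) = 0" for z
    using L(1) X by (simp add: left_diff_distrib sum_subtractf mult.assoc sum_distrib_left[symmetric])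
  define c where "c = Re (Q X)"
  have c: "c \<ge> 0" using psd[OF X] by (simp add: c_def less_eq_complex_def)
  let ?N = "(cmod w)\<^sup>2"
  have "0 \<le> - 2 * t * ?N + t * t * ?N * c" for t :: real
  proof -
    have "0 \<le> Re (Q (\<lambda>i. L i - (t * w) * X i))"
      using psd[OF tan[of "t * w"]] by (simp add: less_eq_complex_def)
    also have "\<dots> = - 2 * t * ?N + t * t * ?N * c"
      unfolding Q_exp L(2) c_def cmod_power2 using psd[OF X]
      by (simp add: less_eq_complex_def power2_eq_square algebra_simps)
    finally show ?thesis .
  qed
  \<comment> \<open>With \<open>t = 1 / (c + 1)\<close> the quadratic equals \<open>- t (1 + t) |w|\<^sup>2\<close>.\<close>
  note quadratic = this
  define t where "t = 1 / (c + 1)"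
  have t: "t > 0" "t * c = 1 - t" using c by (simp_all add: t_def field_simps)
  have "t * t * ?N * c = t * ?N * (t * c)" by simp
  then have "?N * (t * (1 + t)) \<le> 0"
    using quadratic[of t] unfolding t(2) by (simp add: algebra_simps)
  moreover have "t * (1 + t) > 0" using t(1) by simp
  ultimately have "?N \<le> 0" by (metis mult_pos_pos not_le)
  then show ?thesis unfolding w_def[symmetric] by simp
qed

section \<open>Functions with gradient of length one\<close>

text \<open>
  The setting of the eikonal equation. In the notation of the introduction, \<open>a i\<close> and
  \<open>b i\<close> are \<open>\<delta>\<^sub>i\<close> and \<open>\<delta>\<^bsub>i*\<^esub>\<close>, and \<open>h i j\<close> is \<open>\<delta>\<^bsub>ij*\<^esub>\<close>.
\<close>

locale eikonal_function =
  fixes d :: "complex^'n \<Rightarrow> real" and n :: "complex^'n \<Rightarrow> complex^'n" and W :: "(complex^'n) set"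
  assumes open_W: "open W" and smooth: "smooth_on W d"
    and grad: "\<And>x. x \<in> W \<Longrightarrow> (d has_derivative (\<lambda>v. n x \<bullet> v)) (at x)"
    and unit: "\<And>x. x \<in> W \<Longrightarrow> norm (n x) = 1"
begin

abbreviation dc where "dc \<equiv> \<lambda>x. complex_of_real (d x)"
abbreviation a where "a i \<equiv> dz i dc"
abbreviation b where "b i \<equiv> dzbar i dc"
abbreviation h where "h i j \<equiv> dz i (dzbar j dc)"

lemma smooth_dc: "smooth_on W dc"
  using smooth continuously_diff_on_bounded_linear[OF bounded_linear_of_real open_W] unfolding smooth_on_def by blast

lemmas smooths = smooth_dc smooth_on_dz[OF open_W] smooth_on_dzbar[OF open_W]

lemma differentiable_rules:
  assumes "x \<in> W"
  shows "a i differentiable (at x)" "b i differentiable (at x)" "h i j differentiable (at x)"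
    "dzbar j (b i) differentiable (at x)"
  by (rule smooth_on_differentiable[OF _ assms], intro smooths)+

lemma a_eq: "x \<in> W \<Longrightarrow> a i x = cnj (n x $ i) / 2"
  and b_eq: "x \<in> W \<Longrightarrow> b i x = n x $ i / 2"
proof -
  assume x: "x \<in> W"
  have "frechet_derivative dc (at x) = (\<lambda>v. complex_of_real (n x \<bullet> v))"
    by (rule frechet_derivative_at[symmetric], rule bounded_linear.has_derivative[OF bounded_linear_of_real grad[OF x]])
  then show "a i x = cnj (n x $ i) / 2" "b i x = n x $ i / 2"
    unfolding dz_def dzbar_def by (simp_all add: inner_axis inner_complex_def complex_eq_iff)
qed

lemma cnj_b: "x \<in> W \<Longrightarrow> cnj (b i x) = a i x"
  by (simp add: a_eq b_eq)

lemma cnj_a: "x \<in> W \<Longrightarrow> cnj (a i x) = b i x"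
  by (simp add: a_eq b_eq)

lemma eikonal: "x \<in> W \<Longrightarrow> (\<Sum>i\<in>UNIV. a i x * b i x) = 1 / 4"
proof -
  assume x: "x \<in> W"
  have "(\<Sum>i\<in>UNIV. (cmod (n x $ i))\<^sup>2) = 1"
    using unit[OF x] by (simp add: norm_vec_def L2_set_def)
  then have "complex_of_real (\<Sum>i\<in>UNIV. (cmod (n x $ i))\<^sup>2) = 1" by simp
  then have "(\<Sum>i\<in>UNIV. n x $ i * cnj (n x $ i)) = 1"
    unfolding of_real_sum complex_norm_square .
  then show ?thesis
    using x by (simp add: a_eq b_eq mult.commute sum_divide_distrib[symmetric])
qed

lemma h_hermitian: "x \<in> W \<Longrightarrow> cnj (h i j x) = h j i x"
proof -
  assume x: "x \<in> W"
  have "cnj (h i j x) = dzbar i (\<lambda>x. cnj (b j x)) x"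
    by (rule cnj_dz[OF differentiable_rules(2)[OF x]])
  also have "\<dots> = dzbar i (a j) x"
    by (rule dzbar_cong[OF open_W x]) (rule cnj_b)
  also have "\<dots> = h j i x"
    by (rule dz_commute(1)[OF open_W smooth_dc x, symmetric])
  finally show ?thesis .
qed

lemma dzbar_b_eq_cnj:
  assumes x: "x \<in> W"
  shows "dzbar j (b i) x = cnj (dz j (a i) x)"
  unfolding cnj_dz[OF differentiable_rules(1)[OF x]]
  by (rule dzbar_cong[OF open_W x]) (rule cnj_a[symmetric])

lemma eikonal_dz: 
  assumes x: "x \<in> W"
  shows "(\<Sum>i\<in>UNIV. dz k (a i) x * b i x + a i x * h k i x) = 0"
proof -
  have "dz k (\<lambda>x. \<Sum>i\<in>UNIV. a i x * b i x) x = dz k (\<lambda>x. 1 / 4) x"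
    by (rule dz_cong[OF open_W x]) (rule eikonal)
  then show ?thesis
    unfolding dz_const dz_sum_mult[OF differentiable_rules(1,2)[OF x]] .
qed

lemma eikonal_dzbar:
  assumes x: "x \<in> W"
  shows "(\<Sum>i\<in>UNIV. h i j x * b i x) + (\<Sum>i\<in>UNIV. a i x * dzbar j (b i) x) = 0"
proof -
  have "dzbar j (\<lambda>x. \<Sum>i\<in>UNIV. a i x * b i x) x = dzbar j (\<lambda>x. 1 / 4) x"
    by (rule dzbar_cong[OF open_W x]) (rule eikonal)
  then show ?thesis
    unfolding dzbar_const dzbar_sum_mult[OF differentiable_rules(1,2)[OF x]] sum.distrib
      dz_commute(1)[OF open_W smooth_dc x] .
qed

lemma eikonal_dz_dzbar:
  assumes x: "x \<in> W"
  shows "(\<Sum>i\<in>UNIV. dz k (h i j) x * b i x + h i j x * h k i x)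
      + (\<Sum>i\<in>UNIV. dz k (a i) x * dzbar j (b i) x + a i x * dz k (dzbar j (b i)) x) = 0"
proof -
  have diff: "(\<lambda>x. \<Sum>i\<in>UNIV. h i j x * b i x) differentiable (at x)"
    "(\<lambda>x. \<Sum>i\<in>UNIV. a i x * dzbar j (b i) x) differentiable (at x)"
    by (auto intro!: differentiable_sum differentiable_mult differentiable_rules x)
  have "dz k (\<lambda>x. (\<Sum>i\<in>UNIV. h i j x * b i x) + (\<Sum>i\<in>UNIV. a i x * dzbar j (b i) x)) x = dz k (\<lambda>x. 0) x"
    by (rule dz_cong[OF open_W x]) (rule eikonal_dzbar)
  then show ?thesis
    unfolding dz_const dz_add[OF diff] dz_sum_mult[OF differentiable_rules(3,2)[OF x]]
      dz_sum_mult[OF differentiable_rules(1,4)[OF x]] .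
qed

lemma unit_cgrad_eq: "x \<in> W \<Longrightarrow> unit_cgrad d x $ i = complex_of_real (sqrt 8) * b i x"
proof -
  assume x: "x \<in> W"
  have "herm10 (cgrad d x) (cgrad d x) = (\<Sum>i\<in>UNIV. a i x * b i x) / 2"
    unfolding herm10_def cgrad_def by (simp add: cnj_b[OF x] mult.commute)
  then have "herm10 (cgrad d x) (cgrad d x) = complex_of_real (1 / 8)"
    unfolding eikonal[OF x] by simp
  then have "norm10 (cgrad d x) = sqrt (1 / 8)"
    unfolding norm10_def by (simp only: Re_complex_of_real)
  then have "inverse (norm10 (cgrad d x)) = sqrt 8"
    by (simp add: real_sqrt_divide)
  then show ?thesis
    unfolding unit_cgrad_def by (simp add: cgrad_def) (simp add: scaleR_conv_of_real)
qed

lemma cov_deriv_unit_cgrad: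
  assumes x: "x \<in> W"
  shows "cov_deriv (unit_cgrad d) (unit_cgrad d) x $ j = 8 * (\<Sum>i\<in>UNIV. b i x * h i j x)"
proof -
  have "dz i (\<lambda>q. unit_cgrad d q $ j) x = complex_of_real (sqrt 8) * h i j x" for i
  proof -
    have "dz i (\<lambda>q. unit_cgrad d q $ j) x = dz i (\<lambda>q. complex_of_real (sqrt 8) * b j q) x"
      by (rule dz_cong[OF open_W x]) (rule unit_cgrad_eq)
    then show ?thesis unfolding dz_cmult[OF differentiable_rules(2)[OF x]] .
  qed
  then have "cov_deriv (unit_cgrad d) (unit_cgrad d) x $ j
      = (\<Sum>i\<in>UNIV. (complex_of_real (sqrt 8) * complex_of_real (sqrt 8)) * (b i x * h i j x))"
    unfolding cov_deriv_def vec_deriv_def by (simp add: unit_cgrad_eq[OF x] mult_ac)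
  then show ?thesis
    unfolding of_real_mult[symmetric] by (simp add: sum_distrib_left)
qed

text \<open>
  The contractions \<open>\<tau>\<close>, \<open>\<alpha>\<close> and \<open>\<beta>\<close> of the introduction.
\<close>

definition third_order where "third_order X x = (\<Sum>j\<in>UNIV. \<Sum>k\<in>UNIV. \<Sum>i\<in>UNIV. b i x * dz k (h i j) x * X $ k * cnj (X $ j))"
definition hess20 where "hess20 X x i = (\<Sum>k\<in>UNIV. X $ k * dz k (a i) x)"
definition hess11 where "hess11 X x i = (\<Sum>k\<in>UNIV. X $ k * h k i x)"

lemma cnj_hess11: "x \<in> W \<Longrightarrow> cnj (hess11 X x i) = (\<Sum>j\<in>UNIV. h i j x * cnj (X $ j))"
  by (simp add: hess11_def h_hermitian mult.commute)

lemma sum_hess11_cnj: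
  assumes "x \<in> W"
  shows "(\<Sum>i\<in>UNIV. hess11 X x i * cnj (hess11 X x i))
    = (\<Sum>j\<in>UNIV. \<Sum>k\<in>UNIV. \<Sum>i\<in>UNIV. h k i x * h i j x * X $ k * cnj (X $ j))"
proof -
  have "(\<Sum>i\<in>UNIV. hess11 X x i * cnj (hess11 X x i))
      = (\<Sum>i\<in>UNIV. \<Sum>j\<in>UNIV. \<Sum>k\<in>UNIV. h k i x * h i j x * X $ k * cnj (X $ j))"
    unfolding cnj_hess11[OF assms] unfolding hess11_def sum_distrib_left sum_distrib_right by (simp only: mult_ac)
  also have "\<dots> = (\<Sum>j\<in>UNIV. \<Sum>i\<in>UNIV. \<Sum>k\<in>UNIV. h k i x * h i j x * X $ k * cnj (X $ j))"
    by (rule sum.swap)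
  also have "\<dots> = (\<Sum>j\<in>UNIV. \<Sum>k\<in>UNIV. \<Sum>i\<in>UNIV. h k i x * h i j x * X $ k * cnj (X $ j))"
    by (rule sum.cong[OF refl], rule sum.swap)
  finally show ?thesis .
qed

text \<open>
  Since \<open>N\<close> is a constant multiple of the complex gradient on the whole neighbourhood, no derivative
  of the normalising factor occurs.
\<close>

lemma herm10_cov_deriv:
  assumes x: "x \<in> W"
  shows "herm10 (cov_deriv L (cov_deriv (unit_cgrad d) (unit_cgrad d)) x) (L x)
    = 4 * ((\<Sum>i\<in>UNIV. hess11 (L x) x i * cnj (hess11 (L x) x i)) + third_order (L x) x)"
proof -
  have "dz k (\<lambda>q. cov_deriv (unit_cgrad d) (unit_cgrad d) q $ j) x
      = 8 * (\<Sum>i\<in>UNIV. h k i x * h i j x + b i x * dz k (h i j) x)" for k j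
  proof -
    have diff: "(\<lambda>x. \<Sum>i\<in>UNIV. b i x * h i j x) differentiable (at x)"
      by (auto intro!: differentiable_sum differentiable_mult differentiable_rules x)
    have "dz k (\<lambda>q. cov_deriv (unit_cgrad d) (unit_cgrad d) q $ j) x
        = dz k (\<lambda>q. 8 * (\<Sum>i\<in>UNIV. b i q * h i j q)) x"
      by (rule dz_cong[OF open_W x]) (rule cov_deriv_unit_cgrad)
    then show ?thesis
      unfolding dz_cmult[OF diff] dz_sum_mult[OF differentiable_rules(2,3)[OF x]] .
  qed
  then have cov: "cov_deriv L (cov_deriv (unit_cgrad d) (unit_cgrad d)) x $ j
      = 8 * (\<Sum>k\<in>UNIV. \<Sum>i\<in>UNIV. L x $ k * (h k i x * h i j x + b i x * dz k (h i j) x))" for j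
    unfolding cov_deriv_def vec_deriv_def by (simp add: sum_distrib_left mult_ac)
  have "herm10 (cov_deriv L (cov_deriv (unit_cgrad d) (unit_cgrad d)) x) (L x)
      = 4 * (\<Sum>j\<in>UNIV. (\<Sum>k\<in>UNIV. \<Sum>i\<in>UNIV. L x $ k * (h k i x * h i j x + b i x * dz k (h i j) x)) * cnj (L x $ j))"
    unfolding herm10_def cov by (simp add: mult.assoc sum_distrib_left[symmetric])
  also have "\<dots> = 4 * ((\<Sum>i\<in>UNIV. hess11 (L x) x i * cnj (hess11 (L x) x i)) + third_order (L x) x)"
    unfolding sum_hess11_cnj[OF x] third_order_def sum.distrib[symmetric] sum_distrib_right
    by (simp only: algebra_simps)
  finally show ?thesis .
qed

text \<open>
  The eikonal equation differentiated along \<open>X\<close>.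
\<close>

lemma first_order_relation: "x \<in> W \<Longrightarrow> (\<Sum>i\<in>UNIV. hess20 X x i * b i x) + (\<Sum>i\<in>UNIV. hess11 X x i * a i x) = 0"
proof -
  assume x: "x \<in> W"
  have "(\<Sum>i\<in>UNIV. hess20 X x i * b i x) + (\<Sum>i\<in>UNIV. hess11 X x i * a i x)
      = (\<Sum>i\<in>UNIV. \<Sum>k\<in>UNIV. X $ k * (dz k (a i) x * b i x + a i x * h k i x))"
    unfolding hess20_def hess11_def sum.distrib[symmetric] sum_distrib_right by (simp add: algebra_simps)
  also have "\<dots> = (\<Sum>k\<in>UNIV. X $ k * (\<Sum>i\<in>UNIV. dz k (a i) x * b i x + a i x * h k i x))"
    unfolding sum_distrib_left by (rule sum.swap)
  finally show ?thesis using eikonal_dz[OF x] by simp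
qed

lemma sum_hess20_cnj:
  assumes "x \<in> W"
  shows "(\<Sum>i\<in>UNIV. hess20 X x i * cnj (hess20 X x i))
    = (\<Sum>j\<in>UNIV. \<Sum>k\<in>UNIV. \<Sum>i\<in>UNIV. dz k (a i) x * dzbar j (b i) x * X $ k * cnj (X $ j))"
proof -
  have "(\<Sum>i\<in>UNIV. hess20 X x i * cnj (hess20 X x i))
      = (\<Sum>i\<in>UNIV. \<Sum>j\<in>UNIV. \<Sum>k\<in>UNIV. dz k (a i) x * dzbar j (b i) x * X $ k * cnj (X $ j))"
    unfolding hess20_def cnj_sum complex_cnj_mult dzbar_b_eq_cnj[OF assms, symmetric] sum_distrib_left sum_distrib_right
    by (simp only: mult_ac)
  also have "\<dots> = (\<Sum>j\<in>UNIV. \<Sum>i\<in>UNIV. \<Sum>k\<in>UNIV. dz k (a i) x * dzbar j (b i) x * X $ k * cnj (X $ j))"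
    by (rule sum.swap)
  also have "\<dots> = (\<Sum>j\<in>UNIV. \<Sum>k\<in>UNIV. \<Sum>i\<in>UNIV. dz k (a i) x * dzbar j (b i) x * X $ k * cnj (X $ j))"
    by (rule sum.cong[OF refl], rule sum.swap)
  finally show ?thesis .
qed

lemma cnj_third_order:
  assumes x: "x \<in> W"
  shows "cnj (third_order X x) = (\<Sum>j\<in>UNIV. \<Sum>k\<in>UNIV. \<Sum>i\<in>UNIV. a i x * dz k (dzbar j (b i)) x * X $ k * cnj (X $ j))"
proof -
  have third: "cnj (dz k (h i j) x) = dz j (dzbar k (b i)) x" for i j k
  proof -
    have "cnj (dz k (h i j) x) = dzbar k (\<lambda>x. cnj (h i j x)) x"
      by (rule cnj_dz[OF differentiable_rules(3)[OF x]])
    also have "\<dots> = dzbar k (h j i) x"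
      by (rule dzbar_cong[OF open_W x]) (rule h_hermitian)
    also have "\<dots> = dz j (dzbar k (b i)) x"
      by (rule dz_commute(1)[OF open_W smooths(3)[OF smooth_dc] x, symmetric])
    finally show ?thesis .
  qed
  have "cnj (third_order X x) = (\<Sum>j\<in>UNIV. \<Sum>k\<in>UNIV. \<Sum>i\<in>UNIV. a i x * dz j (dzbar k (b i)) x * X $ j * cnj (X $ k))"
    unfolding third_order_def by (simp add: third cnj_b[OF x] mult_ac)
  then show ?thesis by (subst sum.swap)
qed

text \<open>
  The eikonal equation differentiated along \<open>X\<close> and its conjugate, with constant coefficients. This is the complex form of the
  Riccati equation for the Hessian of a distance function.
\<close>

lemma second_order_relation:
  assumes x: "x \<in> W"
  shows "third_order X x + cnj (third_order X x) + (\<Sum>i\<in>UNIV. hess20 X x i * cnj (hess20 X x i)) + (\<Sum>i\<in>UNIV. hess11 X x i * cnj (hess11 X x i)) = 0"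
proof -
  have "third_order X x + cnj (third_order X x) + (\<Sum>i\<in>UNIV. hess20 X x i * cnj (hess20 X x i)) + (\<Sum>i\<in>UNIV. hess11 X x i * cnj (hess11 X x i))
    = (\<Sum>j\<in>UNIV. \<Sum>k\<in>UNIV. X $ k * cnj (X $ j) *
        ((\<Sum>i\<in>UNIV. dz k (h i j) x * b i x + h i j x * h k i x)
      + (\<Sum>i\<in>UNIV. dz k (a i) x * dzbar j (b i) x + a i x * dz k (dzbar j (b i)) x)))"
    unfolding cnj_third_order[OF x] sum_hess20_cnj[OF x] sum_hess11_cnj[OF x]
    unfolding third_order_def sum.distrib[symmetric] sum_distrib_left
    by (intro sum.cong refl) (simp add: algebra_simps)
  then show ?thesis using eikonal_dz_dzbar[OF x] by simp
qed

end

section \<open>The inequality on the null set\<close>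

context eikonal_function
begin

text \<open>
  The part \<open>Y\<close> of the row \<open>hess11 X x\<close> that is orthogonal to the gradient is itself a tangent vector.
  It can therefore be inserted into the identity for null vectors, which gives \<open>|Y|\<^sup>2 = 0\<close>.
\<close>

lemma hess11_null_vector:
  assumes x: "x \<in> W"
    and psd: "\<And>Y. (\<Sum>i\<in>UNIV. Y $ i * a i x) = 0 \<Longrightarrow> complex_hess d x Y \<ge> 0"
    and X: "(\<Sum>i\<in>UNIV. X $ i * a i x) = 0" "complex_hess d x X = 0"
  shows "hess11 X x i = 4 * (\<Sum>j\<in>UNIV. hess11 X x j * a j x) * b i x"
proof -
  define \<beta> where "\<beta> = (\<Sum>j\<in>UNIV. hess11 X x j * a j x)"
  define Y where "Y i = hess11 X x i - 4 * \<beta> * b i x" for i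
  have Y: "(\<Sum>i\<in>UNIV. Y i * a i x) = 0"
  proof -
    have "(\<Sum>i\<in>UNIV. Y i * a i x) = (\<Sum>i\<in>UNIV. hess11 X x i * a i x) - 4 * \<beta> * (\<Sum>i\<in>UNIV. a i x * b i x)"
      unfolding Y_def sum_distrib_left sum_subtractf[symmetric] by (simp add: algebra_simps)
    then show ?thesis unfolding eikonal[OF x] \<beta>_def[symmetric] by simp
  qed
  have BY: "(\<Sum>j\<in>UNIV. hess11 X x j * cnj (Y j)) = 0"
    unfolding hess11_def
  proof (rule semidefinite_null_vector[where a = "\<lambda>i. a i x" and h = "\<lambda>i j. h i j x", OF h_hermitian[OF x] _ X(1) _ Y])
    fix Z :: "'n \<Rightarrow> complex" assume "(\<Sum>i\<in>UNIV. Z i * a i x) = 0"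
    then show "0 \<le> (\<Sum>i\<in>UNIV. \<Sum>j\<in>UNIV. h i j x * Z i * cnj (Z j))"
      using psd[of "\<chi> i. Z i"] by (simp add: complex_hess_def)
  qed (use X(2) in \<open>simp add: complex_hess_def\<close>)
  have bY: "(\<Sum>j\<in>UNIV. b j x * cnj (Y j)) = 0"
  proof -
    have "(\<Sum>j\<in>UNIV. b j x * cnj (Y j)) = cnj (\<Sum>i\<in>UNIV. Y i * a i x)"
      by (simp add: cnj_a[OF x] mult.commute)
    then show ?thesis by (simp add: Y)
  qed
  have "(\<Sum>j\<in>UNIV. Y j * cnj (Y j)) = (\<Sum>j\<in>UNIV. hess11 X x j * cnj (Y j)) - 4 * \<beta> * (\<Sum>j\<in>UNIV. b j x * cnj (Y j))"
    unfolding sum_distrib_left sum_subtractf[symmetric] by (simp add: Y_def algebra_simps)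
  then have "(\<Sum>j\<in>UNIV. Y j * cnj (Y j)) = 0" by (simp add: BY bY)
  then have "complex_of_real (\<Sum>j\<in>UNIV. (cmod (Y j))\<^sup>2) = 0"
    unfolding of_real_sum complex_norm_square .
  then have "(\<Sum>j\<in>UNIV. (cmod (Y j))\<^sup>2) = 0" by (simp only: of_real_eq_0_iff)
  then have "Y i = 0" by (simp add: sum_nonneg_eq_0_iff)
  then show ?thesis unfolding Y_def \<beta>_def by simp
qed

lemma complex_hess_real: "x \<in> W \<Longrightarrow> Im (complex_hess d x X) = 0"
proof -
  assume x: "x \<in> W"
  have "cnj (complex_hess d x X) = (\<Sum>i\<in>UNIV. \<Sum>j\<in>UNIV. h j i x * X $ j * cnj (X $ i))"
    unfolding complex_hess_def by (simp add: h_hermitian[OF x] mult_ac)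
  also have "\<dots> = complex_hess d x X" unfolding complex_hess_def by (rule sum.swap)
  finally show ?thesis by (simp add: complex_eq_iff)
qed

text \<open>
  The derivative of the Levi form of \<open>L\<close> along the complex gradient. Differentiating \<open>Ld = 0\<close> and its
  conjugate gives the gradient components of the derivatives of \<open>L\<close> and of \<open>cnj L\<close>; by the
  assumption on \<open>hess11\<close> these are the only components that matter, and their contributions cancel.
\<close>

lemma normal_derivative_complex_hess:
  assumes x: "x \<in> W" and U: "open U" "x \<in> U" "smooth_on U L"
    and tangent: "\<And>q. q \<in> U \<inter> W \<Longrightarrow> (\<Sum>i\<in>UNIV. L q $ i * a i q) = 0"
    and B: "\<And>i. hess11 (L x) x i = 4 * (\<Sum>j\<in>UNIV. hess11 (L x) x j * a j x) * b i x"
  shows "(\<Sum>k\<in>UNIV. b k x * dz k (\<lambda>q. complex_hess d q (L q)) x) = third_order (L x) x"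
proof -
  define \<beta> where "\<beta> = (\<Sum>j\<in>UNIV. hess11 (L x) x j * a j x)"
  have open_UW: "open (U \<inter> W)" and xUW: "x \<in> U \<inter> W" using U open_W x by auto
  have diff_L: "(\<lambda>q. L q $ i) differentiable (at x)" for i
    using bounded_linear.has_derivative[OF bounded_linear_vec_nth] smooth_on_has_derivative[OF U(3,2)]
    unfolding differentiable_def by blast
  have diff_cL: "(\<lambda>q. cnj (L q $ i)) differentiable (at x)" for i
    using bounded_linear.has_derivative[OF bounded_linear_cnj] diff_L[of i]
    unfolding differentiable_def by blast
  note diff = differentiable_rules[OF x] diff_L diff_cL
  define Y where "Y i = (\<Sum>k\<in>UNIV. b k x * dz k (\<lambda>q. L q $ i) x)" for i
  define Z where "Z i = (\<Sum>k\<in>UNIV. b k x * dz k (\<lambda>q. cnj (L q $ i)) x)" for i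
  have Ya: "(\<Sum>i\<in>UNIV. Y i * a i x) = \<beta>"
  proof -
    have "(\<Sum>i\<in>UNIV. dz k (\<lambda>q. L q $ i) x * a i x + L x $ i * dz k (a i) x) = 0" for k
    proof -
      have "dz k (\<lambda>q. \<Sum>i\<in>UNIV. L q $ i * a i q) x = dz k (\<lambda>q. 0) x"
        by (rule dz_cong[OF open_UW xUW]) (rule tangent)
      then show ?thesis unfolding dz_const dz_sum_mult[OF diff(5,1)] .
    qed
    then have "0 = (\<Sum>k\<in>UNIV. b k x * (\<Sum>i\<in>UNIV. dz k (\<lambda>q. L q $ i) x * a i x + L x $ i * dz k (a i) x))"
      by simp
    also have "\<dots> = (\<Sum>k\<in>UNIV. \<Sum>i\<in>UNIV. b k x * dz k (\<lambda>q. L q $ i) x * a i x)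
        + (\<Sum>k\<in>UNIV. \<Sum>i\<in>UNIV. b k x * (L x $ i * dz i (a k) x))"
      unfolding sum_distrib_left sum.distrib[symmetric]
      by (simp add: dz_commute(2)[OF open_W smooth_dc x] algebra_simps)
    also have "\<dots> = (\<Sum>i\<in>UNIV. Y i * a i x) + (\<Sum>k\<in>UNIV. hess20 (L x) x k * b k x)"
      unfolding Y_def hess20_def sum_distrib_right
      by (subst sum.swap) (simp add: mult_ac)
    finally have "(\<Sum>i\<in>UNIV. Y i * a i x) = - (\<Sum>k\<in>UNIV. hess20 (L x) x k * b k x)"
      by (simp add: eq_neg_iff_add_eq_0)
    moreover have "\<beta> = - (\<Sum>k\<in>UNIV. hess20 (L x) x k * b k x)"
      using first_order_relation[OF x, of "L x"] unfolding \<beta>_def by (simp add: eq_neg_iff_add_eq_0 add.commute)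
    ultimately show ?thesis by simp
  qed
  have Zb: "(\<Sum>i\<in>UNIV. Z i * b i x) = - cnj \<beta>"
  proof -
    have "(\<Sum>i\<in>UNIV. dz k (\<lambda>q. cnj (L q $ i)) x * b i x + cnj (L x $ i) * h k i x) = 0" for k
    proof -
      have "(\<Sum>i\<in>UNIV. cnj (L q $ i) * b i q) = 0" if q: "q \<in> U \<inter> W" for q
        using arg_cong[OF tangent[OF q], of cnj] cnj_a[of q] q by simp
      then have "dz k (\<lambda>q. \<Sum>i\<in>UNIV. cnj (L q $ i) * b i q) x = dz k (\<lambda>q. 0) x"
        by (rule dz_cong[OF open_UW xUW])
      then show ?thesis unfolding dz_const dz_sum_mult[OF diff(6,2)] .
    qed
    then have "0 = (\<Sum>k\<in>UNIV. b k x * (\<Sum>i\<in>UNIV. dz k (\<lambda>q. cnj (L q $ i)) x * b i x + cnj (L x $ i) * h k i x))"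
      by simp
    also have "\<dots> = (\<Sum>k\<in>UNIV. \<Sum>i\<in>UNIV. b k x * dz k (\<lambda>q. cnj (L q $ i)) x * b i x)
        + (\<Sum>k\<in>UNIV. b k x * cnj (hess11 (L x) x k))"
      unfolding cnj_hess11[OF x] sum_distrib_left sum.distrib[symmetric] by (simp add: algebra_simps)
    also have "(\<Sum>k\<in>UNIV. \<Sum>i\<in>UNIV. b k x * dz k (\<lambda>q. cnj (L q $ i)) x * b i x) = (\<Sum>i\<in>UNIV. Z i * b i x)"
      unfolding Z_def sum_distrib_right by (rule sum.swap)
    also have "(\<Sum>k\<in>UNIV. b k x * cnj (hess11 (L x) x k)) = cnj \<beta>"
      unfolding \<beta>_def by (simp add: cnj_a[OF x] mult.commute)
    finally show ?thesis by (simp add: eq_neg_iff_add_eq_0)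
  qed
  have d1: "(\<lambda>q. h i j q * L q $ i * cnj (L q $ j)) differentiable (at x)" for i j
    by (intro differentiable_mult diff)
  then have d2: "(\<lambda>q. \<Sum>j\<in>UNIV. h i j q * L q $ i * cnj (L q $ j)) differentiable (at x)" for i
    by (intro differentiable_sum) auto
  have dz_term: "dz k (\<lambda>q. h i j q * L q $ i * cnj (L q $ j)) x =
      dz k (h i j) x * L x $ i * cnj (L x $ j) + h i j x * dz k (\<lambda>q. L q $ i) x * cnj (L x $ j)
      + h i j x * L x $ i * dz k (\<lambda>q. cnj (L q $ j)) x" for i j k
    by (simp add: dz_mult diff differentiable_mult algebra_simps)
  have dz_hess: "dz k (\<lambda>q. complex_hess d q (L q)) x = (\<Sum>i\<in>UNIV. \<Sum>j\<in>UNIV.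
      dz k (h i j) x * L x $ i * cnj (L x $ j) + h i j x * dz k (\<lambda>q. L q $ i) x * cnj (L x $ j)
      + h i j x * L x $ i * dz k (\<lambda>q. cnj (L q $ j)) x)" for k
    unfolding complex_hess_def
    unfolding dz_sum[OF d2] dz_sum[OF d1] dz_term ..
  have "(\<Sum>k\<in>UNIV. b k x * dz k (\<lambda>q. complex_hess d q (L q)) x)
      = (\<Sum>k\<in>UNIV. \<Sum>i\<in>UNIV. \<Sum>j\<in>UNIV. b k x * dz k (h i j) x * L x $ i * cnj (L x $ j))
      + (\<Sum>k\<in>UNIV. \<Sum>i\<in>UNIV. \<Sum>j\<in>UNIV. b k x * dz k (\<lambda>q. L q $ i) x * (h i j x * cnj (L x $ j)))
      + (\<Sum>k\<in>UNIV. \<Sum>i\<in>UNIV. \<Sum>j\<in>UNIV. L x $ i * h i j x * (b k x * dz k (\<lambda>q. cnj (L q $ j)) x))"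
    unfolding dz_hess sum_distrib_left sum.distrib[symmetric]
    by (intro sum.cong refl) (simp add: algebra_simps)
  also have "(\<Sum>k\<in>UNIV. \<Sum>i\<in>UNIV. \<Sum>j\<in>UNIV. b k x * dz k (h i j) x * L x $ i * cnj (L x $ j)) = third_order (L x) x"
  proof -
    have "third_order (L x) x = (\<Sum>j\<in>UNIV. \<Sum>k\<in>UNIV. \<Sum>i\<in>UNIV. b i x * dz i (h k j) x * L x $ k * cnj (L x $ j))"
      unfolding third_order_def by (simp only: dz_commute(2)[OF open_W smooths(3)[OF smooth_dc] x])
    also have "\<dots> = (\<Sum>j\<in>UNIV. \<Sum>i\<in>UNIV. \<Sum>k\<in>UNIV. b i x * dz i (h k j) x * L x $ k * cnj (L x $ j))"
      by (rule sum.cong[OF refl], rule sum.swap)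
    also have "\<dots> = (\<Sum>i\<in>UNIV. \<Sum>j\<in>UNIV. \<Sum>k\<in>UNIV. b i x * dz i (h k j) x * L x $ k * cnj (L x $ j))"
      by (rule sum.swap)
    also have "\<dots> = (\<Sum>i\<in>UNIV. \<Sum>k\<in>UNIV. \<Sum>j\<in>UNIV. b i x * dz i (h k j) x * L x $ k * cnj (L x $ j))"
      by (rule sum.cong[OF refl], rule sum.swap)
    finally show ?thesis by simp
  qed
  also have "(\<Sum>k\<in>UNIV. \<Sum>i\<in>UNIV. \<Sum>j\<in>UNIV. b k x * dz k (\<lambda>q. L q $ i) x * (h i j x * cnj (L x $ j)))
      = (\<Sum>i\<in>UNIV. Y i * cnj (hess11 (L x) x i))"
    unfolding Y_def cnj_hess11[OF x] sum_distrib_left[symmetric] sum_distrib_right by (rule sum.swap)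
  also have "\<dots> = 4 * cnj \<beta> * (\<Sum>i\<in>UNIV. Y i * a i x)"
    unfolding sum_distrib_left by (subst B) (simp add: \<beta>_def[symmetric] cnj_b[OF x] mult_ac)
  also have "(\<Sum>k\<in>UNIV. \<Sum>i\<in>UNIV. \<Sum>j\<in>UNIV. L x $ i * h i j x * (b k x * dz k (\<lambda>q. cnj (L q $ j)) x))
      = (\<Sum>j\<in>UNIV. hess11 (L x) x j * Z j)"
  proof -
    have "(\<Sum>j\<in>UNIV. hess11 (L x) x j * Z j)
        = (\<Sum>j\<in>UNIV. \<Sum>k\<in>UNIV. \<Sum>i\<in>UNIV. L x $ i * h i j x * (b k x * dz k (\<lambda>q. cnj (L q $ j)) x))"
      unfolding hess11_def Z_def sum_distrib_left sum_distrib_right ..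
    also have "\<dots> = (\<Sum>k\<in>UNIV. \<Sum>j\<in>UNIV. \<Sum>i\<in>UNIV. L x $ i * h i j x * (b k x * dz k (\<lambda>q. cnj (L q $ j)) x))"
      by (rule sum.swap)
    also have "\<dots> = (\<Sum>k\<in>UNIV. \<Sum>i\<in>UNIV. \<Sum>j\<in>UNIV. L x $ i * h i j x * (b k x * dz k (\<lambda>q. cnj (L q $ j)) x))"
      by (rule sum.cong[OF refl], rule sum.swap)
    finally show ?thesis by simp
  qed
  also have "\<dots> = 4 * \<beta> * (\<Sum>j\<in>UNIV. Z j * b j x)"
    unfolding sum_distrib_left by (subst B) (simp add: \<beta>_def[symmetric] mult_ac)
  finally show ?thesis unfolding Ya Zb by (simp add: mult.commute)
qed

text \<open>
  The imaginary part of the derivative of a real function along the complex gradient \<open>X = n/2\<close> is, up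
  to a factor, its derivative along \<open>\<i> X\<close>, which is orthogonal to \<open>n\<close>.
\<close>

lemma Im_third_order_eq_0:
  assumes x: "x \<in> W" and U: "open U" "x \<in> U" "smooth_on U L"
    and tangent: "\<And>q. q \<in> U \<inter> W \<Longrightarrow> (\<Sum>i\<in>UNIV. L q $ i * a i q) = 0"
    and B: "\<And>i. hess11 (L x) x i = 4 * (\<Sum>j\<in>UNIV. hess11 (L x) x j * a j x) * b i x"
    and crit: "\<And>g' v. ((\<lambda>q. Re (complex_hess d q (L q))) has_derivative g') (at x) \<Longrightarrow> n x \<bullet> v = 0 \<Longrightarrow> g' v = 0"
  shows "Im (third_order (L x) x) = 0"
proof -
  let ?f = "\<lambda>q. complex_hess d q (L q)"
  have diff_L: "(\<lambda>q. L q $ i) differentiable (at x)" for i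
    using bounded_linear.has_derivative[OF bounded_linear_vec_nth] smooth_on_has_derivative[OF U(3,2)]
    unfolding differentiable_def by blast
  have diff_cL: "(\<lambda>q. cnj (L q $ i)) differentiable (at x)" for i
    using bounded_linear.has_derivative[OF bounded_linear_cnj] diff_L[of i]
    unfolding differentiable_def by blast
  have diff: "?f differentiable (at x)"
    unfolding complex_hess_def
    by (auto intro!: differentiable_sum differentiable_mult differentiable_rules[OF x] diff_L diff_cL)
  let ?D = "frechet_derivative ?f (at x)"
  have der: "(?f has_derivative ?D) (at x)" using diff by (simp add: frechet_derivative_works)
  have reD: "((\<lambda>q. Re (?f q)) has_derivative (\<lambda>v. Re (?D v))) (at x)"
    by (rule bounded_linear.has_derivative[OF bounded_linear_Re der])
  have "((\<lambda>q. 0) has_derivative (\<lambda>v. Im (?D v))) (at x)"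
    by (rule has_derivative_transform_within_open[OF bounded_linear.has_derivative[OF bounded_linear_Im der] open_W x])
       (simp add: complex_hess_real)
  then have "(\<lambda>v. Im (?D v)) = (\<lambda>v. 0)"
    using has_derivative_unique has_derivative_const by blast
  then have ImD: "Im (?D v) = 0" for v by metis
  define X where "X = (\<chi> i. b i x)"
  have "n x \<bullet> (\<i> *s X) = 0"
    by (simp add: X_def b_eq[OF x] inner_vec_def inner_complex_def)
  then have "Re (?D (\<i> *s X)) = 0" by (rule crit[OF reD])
  then have "?D (\<i> *s X) = 0" using ImD by (simp add: complex_eq_iff)
  then have "Im (vec_deriv X ?f x) = 0"
    unfolding vec_deriv_eq_frechet[OF diff] by (simp add: ImD)
  moreover have "(\<Sum>k\<in>UNIV. b k x * dz k ?f x) = third_order (L x) x"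
    using x U tangent B by (rule normal_derivative_complex_hess)
  then have "vec_deriv X ?f x = third_order (L x) x"
    unfolding vec_deriv_def X_def by simp
  ultimately show ?thesis by simp
qed

lemma herm10_cov_deriv_nonpos:
  assumes x: "x \<in> W" and U: "open U" "x \<in> U" "smooth_on U L"
    and tangent: "\<And>q. q \<in> U \<inter> W \<Longrightarrow> (\<Sum>i\<in>UNIV. L q $ i * a i q) = 0"
    and psd: "\<And>Y. (\<Sum>i\<in>UNIV. Y $ i * a i x) = 0 \<Longrightarrow> complex_hess d x Y \<ge> 0"
    and null: "complex_hess d x (L x) = 0"
    and crit: "\<And>g' v. ((\<lambda>q. Re (complex_hess d q (L q))) has_derivative g') (at x) \<Longrightarrow> n x \<bullet> v = 0 \<Longrightarrow> g' v = 0"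
  shows "herm10 (cov_deriv L (cov_deriv (unit_cgrad d) (unit_cgrad d)) x) (L x) \<le> 0"
proof -
  let ?X = "L x"
  define \<beta> where "\<beta> = (\<Sum>j\<in>UNIV. hess11 ?X x j * a j x)"
  have B: "hess11 ?X x i = 4 * (\<Sum>j\<in>UNIV. hess11 ?X x j * a j x) * b i x" for i
    by (rule hess11_null_vector[OF x psd tangent null]) (use x U in auto)
  have Im_third: "Im (third_order ?X x) = 0" using x U tangent B crit by (rule Im_third_order_eq_0)
  have b_norm: "(\<Sum>i\<in>UNIV. (cmod (b i x))\<^sup>2) = 1 / 4"
  proof -
    have "complex_of_real (\<Sum>i\<in>UNIV. (cmod (b i x))\<^sup>2) = complex_of_real (1 / 4)"
      unfolding of_real_sum complex_norm_square cnj_b[OF x] using eikonal[OF x] by (simp add: mult.commute)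
    then show ?thesis by (simp only: of_real_eq_iff)
  qed
  let ?A = "\<Sum>i\<in>UNIV. (cmod (hess20 ?X x i))\<^sup>2" and ?B = "\<Sum>i\<in>UNIV. (cmod (hess11 ?X x i))\<^sup>2"
  have BB: "(\<Sum>i\<in>UNIV. hess11 ?X x i * cnj (hess11 ?X x i)) = complex_of_real ?B"
    unfolding of_real_sum complex_norm_square ..
  have AA: "(\<Sum>i\<in>UNIV. hess20 ?X x i * cnj (hess20 ?X x i)) = complex_of_real ?A"
    unfolding of_real_sum complex_norm_square ..
  have "?B = (\<Sum>i\<in>UNIV. 16 * (cmod \<beta>)\<^sup>2 * (cmod (b i x))\<^sup>2)"
    by (subst B) (simp add: \<beta>_def[symmetric] norm_mult power_mult_distrib)
  also have "\<dots> = 4 * (cmod \<beta>)\<^sup>2"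
    unfolding sum_distrib_left[symmetric] b_norm by simp
  finally have B_sq: "?B = 4 * (cmod \<beta>)\<^sup>2" .
  have "(\<Sum>i\<in>UNIV. hess20 ?X x i * b i x) = - \<beta>"
    using first_order_relation[OF x, of ?X] unfolding \<beta>_def by (simp add: eq_neg_iff_add_eq_0)
  then have "cmod \<beta> = cmod (\<Sum>i\<in>UNIV. hess20 ?X x i * b i x)" by simp
  also have "\<dots> \<le> (\<Sum>i\<in>UNIV. cmod (hess20 ?X x i) * cmod (b i x))"
    using norm_sum[of "\<lambda>i. hess20 ?X x i * b i x" UNIV] by (simp add: norm_mult)
  finally have "(cmod \<beta>)\<^sup>2 \<le> (\<Sum>i\<in>UNIV. cmod (hess20 ?X x i) * cmod (b i x))\<^sup>2"
    by (intro power_mono) auto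
  also have "\<dots> \<le> ?A * (\<Sum>i\<in>UNIV. (cmod (b i x))\<^sup>2)"
    by (rule Cauchy_Schwarz_ineq_sum)
  finally have "?B \<le> ?A" unfolding b_norm B_sq by simp
  moreover have "2 * Re (third_order ?X x) + ?A + ?B = 0"
    using arg_cong[OF second_order_relation[OF x, of ?X], of Re] unfolding AA BB by simp
  ultimately show ?thesis
    unfolding herm10_cov_deriv[OF x] BB using Im_third by (simp add: less_eq_complex_def)
qed

end

theorem theorem1p1:
  fixes \<Omega> U :: "(complex^'n) set"
    and L :: "complex^'n \<Rightarrow> complex^'n"
  defines "\<delta> \<equiv> signed_dist \<Omega>"
  defines "N \<equiv> unit_cgrad \<delta>"
  assumes "open \<Omega>" and "connected \<Omega>" and "\<Omega> \<noteq> {}" and "bounded \<Omega>"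
    and "smooth_boundary \<Omega>" and "pseudoconvex \<Omega>"
    and "open U"
    and "smooth_on U L" and "\<forall>q\<in>U. L q \<noteq> 0"
    and "\<exists>W. open W \<and> frontier \<Omega> \<subseteq> W \<and>
           (\<forall>q\<in>U \<inter> W. vec_deriv (L q) (\<lambda>x. complex_of_real (\<delta> x)) q = 0)"
  shows "\<forall>p\<in>null_set \<Omega> U L. herm10 (cov_deriv L (cov_deriv N N) p) (L p) \<le> 0"
proof
  fix p assume "p \<in> null_set \<Omega> U L"
  then have pU: "p \<in> U" and p: "p \<in> frontier \<Omega>" and null: "complex_hess \<delta> p (L p) = 0"
    by (auto simp: null_set_def \<delta>_def)
  obtain W0 where W0: "open W0" "frontier \<Omega> \<subseteq> W0"
    "\<And>q. q \<in> U \<inter> W0 \<Longrightarrow> vec_deriv (L q) (\<lambda>x. complex_of_real (\<delta> x)) q = 0"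
    using assms(12) by blast
  obtain W1 n where W1: "open W1" "p \<in> W1" "smooth_on W1 \<delta>"
    "\<And>x. x \<in> W1 \<Longrightarrow> (\<delta> has_derivative (\<lambda>v. n x \<bullet> v)) (at x)" "\<And>x. x \<in> W1 \<Longrightarrow> norm (n x) = 1"
    using signed_dist_eikonal[OF assms(3,7) p] unfolding \<delta>_def by metis
  define W where "W = W0 \<inter> W1"
  have W: "open W" "p \<in> W" using W0 W1 p by (auto simp: W_def)
  interpret eikonal_function \<delta> n W
  proof
    show "smooth_on W \<delta>" using W1(3) continuously_diff_on_subset unfolding smooth_on_def W_def by blast
  qed (use W W1(4,5) in \<open>auto simp: W_def\<close>)
  have tangent: "(\<Sum>i\<in>UNIV. L q $ i * a i q) = 0" if "q \<in> U \<inter> W" for q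
    using W0(3)[of q] that by (simp add: W_def vec_deriv_def)
  have psd: "complex_hess \<delta> q Y \<ge> 0" if "q \<in> frontier \<Omega>" "(\<Sum>i\<in>UNIV. Y $ i * a i q) = 0" for q Y
    using assms(8) that unfolding pseudoconvex_def tangent10_def vec_deriv_def \<delta>_def by blast
  show "herm10 (cov_deriv L (cov_deriv N N) p) (L p) \<le> 0"
    unfolding N_def
  proof (rule herm10_cov_deriv_nonpos[OF W(2) assms(9) pU assms(10) tangent psd[OF p] null])
    fix g' v assume g': "((\<lambda>q. Re (complex_hess \<delta> q (L q))) has_derivative g') (at p)" and v: "n p \<bullet> v = 0"
    show "g' v = 0"
    proof (rule tangential_derivative_zero_at_min[OF p _ g' _ _ _ _ v])
      show "(signed_dist \<Omega> has_derivative (\<lambda>v. n p \<bullet> v)) (at p)" using W1(4)[OF W1(2)] unfolding \<delta>_def .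
      show "open (U \<inter> W)" "p \<in> U \<inter> W" using assms(9) W pU by auto
      show "0 \<le> Re (complex_hess \<delta> q (L q))" if "q \<in> frontier \<Omega> \<inter> (U \<inter> W)" for q
        using psd[OF _ tangent] that by (auto simp: less_eq_complex_def)
    qed (simp add: null)
  qed auto
qed

end
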